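(* Let $f_1,\ldots,f_n \in \mathbb{C}[z_1,\ldots,z_n]$ be a generic system of $n$ polynomials in $n$ complex variables, let $V = \{z\in(\mathbb{C}^* )^n : f_1(z)=\cdots=f_n(z)=0\}$, and let $\mu = \mu(\Delta_1,\ldots,\Delta_n)$ be the mixed volume of the Newton polytopes $\Delta_1,\ldots,\Delta_n$ of $f_1,\ldots,f_n$. Then the amoeba $\mathscr{A}(V)$ has a finite amoeba basis of length (number of elements) at most $(n+1)(n^{\mu-1}+1)$, and each element of this basis has degree at most $\mu$.
   Context: $\mathrm{Log}:(\mathbb{C}^* )^n\to\mathbb{R}^n$ is the map $\mathrm{Log}(z_1,\ldots,z_n)=(\log|z_1|,\ldots,\log|z_n|)$. The amoeba of a subvariety $V\subset(\mathbb{C}^* )^n$ is $\mathscr{A}(V)=\mathrm{Log}(V)$. For a polynomial $g$, $V_g=\{z\in(\mathbb{C}^* )^n: g(z)=0\}$, with amoeba $\mathscr{A}(V_g)$. Genericity: the system $f_1=\cdots=f_n=0$ (equivalently the variety $V$, which has codimension $n$) is called generic if the Jacobian of the logarithmic map at all points of $V$ has maximal rank, i.e. rank equal to $n$. For a generic system it is also understood that the conclusion of Bernstein's theorem holds: $V$ is a finite set and the number of solutions in $(\mathbb{C}^* )^n$, counted with multiplicity, equals the mixed volume $\mu(\Delta_1,\ldots,\Delta_n)$. Amoeba basis: let $\mathcal{I}(V)$ be the defining ideal of $V$ (the ideal of polynomials vanishing on $V$). A finite set of polynomials $\{g_i\}_{i=1}^l$ generating $\mathcal{I}(V)$ is an amoeba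 basis of $\mathscr{A}(V)$ if (i) $\mathscr{A}(V)=\bigcap_{i=1}^l\mathscr{A}(V_{g_i})$; and (ii) $\mathscr{A}(V)\subsetneq\bigcap_{i\in\{1,\ldots,l\}\setminus\{s\}}\mathscr{A}(V_{g_i})$ for every $1\le s\le l$. Its length is $l$. *)

theory Defs
  imports
    "HOL-Analysis.Analysis"
    "HOL-Library.Poly_Mapping"
    "HOL-Library.Extended_Nat"
    "HOL-Library.Extended_Real"
    "HOL-Computational_Algebra.Fraction_Field"
begin

text \<open>
  Polynomials in the variables \<open>z\<^sub>j\<close>, \<open>j :: 'n\<close>, are finitely supported maps from exponent vectors
  to coefficients. The finite index type plays the role of \<open>{1, \<dots>, n}\<close> with \<open>n = CARD('n)\<close>; its
  order is used only to make the polynomial ring an instance of \<open>idom\<close>, so that its fraction field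
  is available.
\<close>

type_synonym 'n cpoly = "('n \<Rightarrow>\<^sub>0 nat) \<Rightarrow>\<^sub>0 complex"

definition eval_poly :: "'n::finite cpoly \<Rightarrow> complex ^ 'n \<Rightarrow> complex" where
  "eval_poly p z =
     (\<Sum>\<alpha>\<in>Poly_Mapping.keys p. Poly_Mapping.lookup p \<alpha> * (\<Prod>j\<in>UNIV. (z $ j) ^ Poly_Mapping.lookup \<alpha> j))"

text \<open>The zero polynomial gets total degree 0.\<close>

definition total_degree :: "'n::finite cpoly \<Rightarrow> nat" where
  "total_degree p =
     Max (insert 0 ((\<lambda>\<alpha>. \<Sum>j\<in>UNIV. Poly_Mapping.lookup \<alpha> j) ` Poly_Mapping.keys p))"

definition torus :: "(complex ^ 'n::finite) set" where
  "torus = {z. \<forall>j. z $ j \<noteq> 0}"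

definition hypersurface :: "'n::finite cpoly \<Rightarrow> (complex ^ 'n) set" where
  "hypersurface g = {z \<in> torus. eval_poly g z = 0}"

definition solution_set :: "('n::finite \<Rightarrow> 'n cpoly) \<Rightarrow> (complex ^ 'n) set" where
  "solution_set f = {z \<in> torus. \<forall>i. eval_poly (f i) z = 0}"

definition Log :: "complex ^ 'n::finite \<Rightarrow> real ^ 'n" where
  "Log z = (\<chi> j. ln (cmod (z $ j)))"

definition amoeba :: "(complex ^ 'n::finite) set \<Rightarrow> (real ^ 'n) set" where
  "amoeba V = Log ` V"

definition newton_polytope :: "'n::finite cpoly \<Rightarrow> (real ^ 'n) set" where
  "newton_polytope p =
     convex hull ((\<lambda>\<alpha>. \<chi> j. real (Poly_Mapping.lookup \<alpha> j)) ` Poly_Mapping.keys p)"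

text \<open>
  Bernstein's mixed volume, normalised so that \<open>mixed_volume (\<lambda>_. \<Delta>) = n! * vol \<Delta>\<close>:
  the alternating sum of the volumes of the Minkowski sums \<open>\<Sum>i\<in>S. \<Delta> i\<close> over nonempty \<open>S\<close>.
\<close>

definition mixed_volume :: "('n::finite \<Rightarrow> (real ^ 'n) set) \<Rightarrow> real" where
  "mixed_volume \<Delta> =
     (\<Sum>S\<in>Pow UNIV - {{}}. (- 1) ^ (CARD('n) - card S) * measure lebesgue (\<Sum>i\<in>S. \<Delta> i))"

text \<open>
  The multiplicity of a solution \<open>z\<close> is the complex dimension of the local ring at \<open>z\<close> modulo the
  ideal generated by the \<open>f i\<close>. The local ring is taken inside the field of rational functions.
  The dimension is the least size of a finite set spanning the quotient, and \<open>\<infinity>\<close> if there is none.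
\<close>

definition local_ring :: "(complex, 'n::{finite,linorder}) vec \<Rightarrow> 'n cpoly fract set" where
  "local_ring z = {Fract p q | p q. eval_poly q z \<noteq> 0}"

definition local_ideal ::
    "('n::{finite,linorder} \<Rightarrow> 'n cpoly) \<Rightarrow> (complex, 'n) vec \<Rightarrow> 'n cpoly fract set" where
  "local_ideal f z = {\<Sum>i\<in>UNIV. r i * Fract (f i) 1 | r. \<forall>i. r i \<in> local_ring z}"

definition multiplicity_at ::
    "('n::{finite,linorder} \<Rightarrow> 'n cpoly) \<Rightarrow> (complex, 'n) vec \<Rightarrow> enat" where
  "multiplicity_at f z =
     (INF B\<in>{B. finite B \<and> B \<subseteq> local_ring z \<and>
                (\<forall>r\<in>local_ring z. \<exists>c :: 'n cpoly fract \<Rightarrow> complex.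
                   r - (\<Sum>b\<in>B. Fract (Poly_Mapping.single 0 (c b)) 1 * b) \<in> local_ideal f z)}.
        enat (card B))"

text \<open>
  The rank condition concerns the real differential of \<open>Log\<close>, viewed as a map on the open
  subset \<open>torus\<close> of \<open>complex ^ 'n\<close>.
\<close>

definition generic_system :: "('n::{finite,linorder} \<Rightarrow> 'n cpoly) \<Rightarrow> bool" where
  "generic_system f \<longleftrightarrow>
     (\<forall>z\<in>solution_set f. \<exists>D. (Log has_derivative D) (at z) \<and> dim (range D) = CARD('n)) \<and>
     finite (solution_set f) \<and>
     (\<Sum>z\<in>solution_set f. ereal_of_enat (multiplicity_at f z)) =
       ereal (mixed_volume (\<lambda>i. newton_polytope (f i)))"

definition vanishing_ideal :: "(complex ^ 'n::finite) set \<Rightarrow> 'n cpoly set" where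
  "vanishing_ideal V = {p. \<forall>z\<in>V. eval_poly p z = 0}"

text \<open>
  The ideal generated by \<open>G\<close> is the span of \<open>G\<close> in the polynomial ring as a module over itself.
  The intersection over an empty index set is the whole space \<open>real ^ 'n\<close>.
\<close>

definition amoeba_basis :: "(complex ^ 'n::finite) set \<Rightarrow> 'n cpoly set \<Rightarrow> bool" where
  "amoeba_basis V G \<longleftrightarrow>
     finite G \<and>
     module.span (*) G = vanishing_ideal V \<and>
     amoeba V = (\<Inter>g\<in>G. amoeba (hypersurface g)) \<and>
     (\<forall>s\<in>G. amoeba V \<subset> (\<Inter>g\<in>G - {s}. amoeba (hypersurface g)))"

end

theory Submission
  imports Defs
begin

text \<open>
  Let \<open>V\<close> be the solution set and \<open>k = card V\<close>; each multiplicity is at least \<open>1\<close>, so \<open>k \<le> \<mu>\<close>. If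
  \<open>n = 1\<close> or \<open>V = {}\<close>, one polynomial suffices.

  Otherwise put \<open>z\<^sub>0 = 1\<close>. For \<open>v \<in> V\<close>, \<open>i \<in> {0, \<dots>, n}\<close> and positive weights \<open>w\<close>, the affine form
  \<open>\<Sum>\<^sub>j w\<^sub>j (z\<^sub>j / v\<^sub>j - z\<^sub>i / v\<^sub>i)\<close> vanishes at \<open>v\<close> and at no other point where \<open>\<bar>z\<^sub>i / v\<^sub>i\<bar>\<close> is
  maximal among all \<open>\<bar>z\<^sub>j / v\<^sub>j\<bar>\<close>. The generators are products \<open>g \<phi>\<close> over \<open>v \<in> V\<close> of such forms,
  with indices \<open>i = \<phi> v\<close>. A point outside the amoeba of \<open>V\<close> is excluded by \<open>g \<phi>\<close> whenever \<open>\<phi>\<close> selects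
  a maximal coordinate for each \<open>v\<close>, and by an exchange argument one \<open>\<phi>\<close> for each vector of fibre
  sizes is enough, which leaves at most \<open>(n + k choose k) \<le> (n + 1) n ^ (k - 1)\<close> generators.

  Irredundancy is obtained by passing to a minimal subfamily with the same intersection of amoebas.
  It still has at least \<open>n + 1\<close> members, because near a point of the amoeba of \<open>V\<close> each of \<open>n + 1\<close>
  directions must be cut off by a different index. For generic weights any \<open>n + 1\<close> of the products
  generate the vanishing ideal: choosing one factor from each of them leaves no common zero unless all
  chosen factors are centred at the same \<open>v\<close>, and then only \<open>v\<close>.
\<close>

section \<open>Polynomials\<close>

lemma poly_mapping_eq_sum_single:
  "p = (\<Sum>\<alpha>\<in>Poly_Mapping.keys p. Poly_Mapping.single \<alpha> (Poly_Mapping.lookup p \<alpha>))"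
  by (rule poly_mapping_eqI)
    (auto simp: lookup_sum lookup_single when_def in_keys_iff sum.delta)

lemma eval_poly_eq_sum_superset:
  assumes "finite A" "Poly_Mapping.keys p \<subseteq> A"
  shows "eval_poly p z =
    (\<Sum>\<alpha>\<in>A. Poly_Mapping.lookup p \<alpha> * (\<Prod>j\<in>UNIV. (z $ j) ^ Poly_Mapping.lookup \<alpha> j))"
  unfolding eval_poly_def using assms by (intro sum.mono_neutral_left) (auto simp: in_keys_iff)

lemma eval_poly_add [simp]: "eval_poly (p + q) z = eval_poly p z + eval_poly q z"
proof -
  let ?A = "Poly_Mapping.keys p \<union> Poly_Mapping.keys q"
  have "Poly_Mapping.keys (p + q) \<subseteq> ?A"
    by (rule keys_add)
  then show ?thesis
    by (simp add: eval_poly_eq_sum_superset[of ?A] lookup_add sum.distrib algebra_simps)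
qed

lemma eval_poly_zero [simp]: "eval_poly 0 z = 0"
  by (simp add: eval_poly_def)

lemma eval_poly_sum [simp]: "eval_poly (sum p A) z = (\<Sum>a\<in>A. eval_poly (p a) z)"
  by (induction A rule: infinite_finite_induct) auto

lemma eval_poly_single [simp]:
  "eval_poly (Poly_Mapping.single \<alpha> c) z = c * (\<Prod>j\<in>UNIV. (z $ j) ^ Poly_Mapping.lookup \<alpha> j)"
  by (simp add: eval_poly_eq_sum_superset[of "{\<alpha>}"])

lemma eval_poly_mult [simp]: "eval_poly (p * q) z = eval_poly p z * eval_poly q z"
proof -
  have *: "eval_poly (Poly_Mapping.single \<alpha> c * Poly_Mapping.single \<beta> d) z =
      eval_poly (Poly_Mapping.single \<alpha> c) z * eval_poly (Poly_Mapping.single \<beta> d) z" for \<alpha> \<beta> c d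
    by (simp add: mult_single lookup_add power_add prod.distrib)
  show ?thesis
    by (subst (1 2 3 4) poly_mapping_eq_sum_single)
      (simp only: sum_product eval_poly_sum *)
qed

lemma eval_poly_one [simp]: "eval_poly 1 z = 1"
  by (simp flip: single_one)

lemma eval_poly_prod [simp]: "eval_poly (prod p A) z = (\<Prod>a\<in>A. eval_poly (p a) z)"
  by (induction A rule: infinite_finite_induct) auto

lemma eval_poly_diff [simp]: "eval_poly (p - q) z = eval_poly p z - eval_poly q z"
  using eval_poly_add[of "p - q" q z] by simp

lemma total_degree_le_iff:
  "total_degree p \<le> d \<longleftrightarrow> (\<forall>\<alpha>\<in>Poly_Mapping.keys p. (\<Sum>j\<in>UNIV. Poly_Mapping.lookup \<alpha> j) \<le> d)"
  by (simp add: total_degree_def)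

lemma total_degree_mult_le: "total_degree (p * q) \<le> total_degree p + total_degree q"
  unfolding total_degree_le_iff
proof
  fix \<gamma> assume "\<gamma> \<in> Poly_Mapping.keys (p * q)"
  then obtain \<alpha> \<beta> where "\<alpha> \<in> Poly_Mapping.keys p" "\<beta> \<in> Poly_Mapping.keys q" "\<gamma> = \<alpha> + \<beta>"
    using keys_mult[of p q] by auto
  moreover from this have "(\<Sum>j\<in>UNIV. Poly_Mapping.lookup \<alpha> j) \<le> total_degree p"
    "(\<Sum>j\<in>UNIV. Poly_Mapping.lookup \<beta> j) \<le> total_degree q"
    using total_degree_le_iff by blast+
  ultimately show "(\<Sum>j\<in>UNIV. Poly_Mapping.lookup \<gamma> j) \<le> total_degree p + total_degree q"
    by (simp add: lookup_add sum.distrib)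
qed

lemma total_degree_one [simp]: "total_degree 1 = 0"
  by (simp add: total_degree_def)

lemma total_degree_prod_le: "total_degree (prod p A) \<le> (\<Sum>a\<in>A. total_degree (p a))"
proof (induction A rule: infinite_finite_induct)
  case (insert a A)
  then show ?case
    using total_degree_mult_le[of "p a" "prod p A"] by simp
qed auto

section \<open>Constants, variables and monomials as polynomials\<close>

definition const_poly :: "complex \<Rightarrow> 'n::finite cpoly" where
  "const_poly c = Poly_Mapping.single 0 c"

definition var_poly :: "'n::finite \<Rightarrow> 'n cpoly" where
  "var_poly j = Poly_Mapping.single (Poly_Mapping.single j 1) 1"

lemma eval_const_poly [simp]: "eval_poly (const_poly c) z = c"
  by (simp add: const_poly_def)

lemma prod_power_lookup_single:
  "(\<Prod>i\<in>UNIV. (z $ i) ^ Poly_Mapping.lookup (Poly_Mapping.single j (1::nat)) i) = (z :: complex ^ 'n::finite) $ j"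
proof -
  have "(\<Prod>i\<in>UNIV. (z $ i) ^ Poly_Mapping.lookup (Poly_Mapping.single j (1::nat)) i)
      = (\<Prod>i\<in>UNIV. if i = j then z $ j else 1)"
    by (rule prod.cong) (auto simp: lookup_single)
  then show ?thesis
    by simp
qed

lemma eval_var_poly [simp]: "eval_poly (var_poly j) z = z $ j"
  unfolding var_poly_def eval_poly_single prod_power_lookup_single by simp

lemma const_poly_add: "const_poly (a + b) = const_poly a + const_poly b"
  and const_poly_mult: "const_poly (a * b) = const_poly a * const_poly b"
  and const_poly_0 [simp]: "const_poly 0 = 0"
  and const_poly_1 [simp]: "const_poly 1 = 1"
  by (simp_all add: const_poly_def single_add mult_single)

lemma const_poly_sum: "const_poly (sum f A) = (\<Sum>a\<in>A. const_poly (f a))"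
  by (induction A rule: infinite_finite_induct) (auto simp: const_poly_add)

lemma const_poly_prod: "const_poly (prod f A) = (\<Prod>a\<in>A. const_poly (f a))"
  by (induction A rule: infinite_finite_induct) (auto simp: const_poly_mult)

lemma const_poly_power: "const_poly (a ^ m) = const_poly a ^ m"
  by (induction m) (auto simp: const_poly_mult)

text \<open>Reduces congruences between monomials to congruences between variables.\<close>

lemma monomial_eq_prod_var_poly:
  fixes \<alpha> :: "'n::finite \<Rightarrow>\<^sub>0 nat"
  shows "Poly_Mapping.single \<alpha> c = const_poly c * (\<Prod>j\<in>UNIV. var_poly j ^ Poly_Mapping.lookup \<alpha> j)"
proof -
  have pow: "var_poly j ^ m = Poly_Mapping.single (Poly_Mapping.single j m) 1" for j :: 'n and m
    by (induction m) (auto simp: var_poly_def mult_single simp flip: single_add)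
  have pr: "(\<Prod>j\<in>A. Poly_Mapping.single (\<beta> j) (1::complex)) = Poly_Mapping.single (\<Sum>j\<in>A. \<beta> j) 1"
    if "finite A" for A :: "'n set" and \<beta> :: "'n \<Rightarrow> 'n \<Rightarrow>\<^sub>0 nat"
    using that by (induction A) (auto simp: mult_single)
  have "(\<Sum>j\<in>UNIV. Poly_Mapping.single j (Poly_Mapping.lookup \<alpha> j)) = \<alpha>"
    by (rule poly_mapping_eqI) (simp add: lookup_sum lookup_single when_def)
  then show ?thesis
    by (simp add: pow pr const_poly_def mult_single)
qed

section \<open>Ideals\<close>

lemma module_mult: "module ((*) :: 'a::comm_ring_1 \<Rightarrow> 'a \<Rightarrow> 'a)"
  by unfold_locales (auto simp: algebra_simps)

text \<open>An ideal is a submodule of the ring over itself, the form in which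
  \<open>amoeba_basis\<close> speaks of generated ideals.\<close>

abbreviation ideal_set :: "'a::comm_ring_1 set \<Rightarrow> bool" where
  "ideal_set \<equiv> module.subspace (*)"

lemmas ideal_setI = module.subspaceI[OF module_mult]
  and ideal_set_0 = module.subspace_0[OF module_mult]
  and ideal_set_add = module.subspace_add[OF module_mult]
  and ideal_set_diff = module.subspace_diff[OF module_mult]
  and ideal_set_mult = module.subspace_scale[OF module_mult]
  and ideal_set_sum = module.subspace_sum[OF module_mult]

lemma ideal_set_colon:
  assumes "ideal_set J"
  shows "ideal_set {x. x * h \<in> J}"
  using assms
  by (intro ideal_setI) (auto simp: distrib_right mult.assoc ideal_set_0 ideal_set_add ideal_set_mult)

lemma ideal_set_vanishing_ideal: "ideal_set (vanishing_ideal V)"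
  by (intro ideal_setI) (auto simp: vanishing_ideal_def)

lemma ideal_prod_diff:
  assumes "ideal_set J" "\<And>a. a \<in> A \<Longrightarrow> f a - g a \<in> J"
  shows "prod f A - prod g A \<in> J"
  using assms(2)
proof (induction A rule: infinite_finite_induct)
  case (insert a A)
  \<comment> \<open>Telescoping: one factor is exchanged at a time.\<close>
  have "prod f (insert a A) - prod g (insert a A) =
      prod f A * (f a - g a) + g a * (prod f A - prod g A)"
    using insert.hyps by (simp add: algebra_simps)
  with insert show ?case
    using assms(1) by (auto intro!: ideal_set_add ideal_set_mult)
qed (auto simp: assms(1) ideal_set_0)

lemma ideal_power_diff:
  assumes "ideal_set J" "a - b \<in> J"
  shows "a ^ m - b ^ m \<in> J"
  using ideal_prod_diff[OF assms(1), of "{..<m}" "\<lambda>_. a" "\<lambda>_. b"] assms(2) by simp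

text \<open>Modulo \<open>J\<close> every variable is a constant, hence so is every
  polynomial.\<close>

lemma poly_minus_eval_in_ideal:
  assumes J: "ideal_set J" and v: "\<And>j. var_poly j - const_poly (v $ j) \<in> J"
  shows "p - const_poly (eval_poly p v) \<in> J"
proof -
  have mono: "Poly_Mapping.single \<alpha> c -
      const_poly (c * (\<Prod>j\<in>UNIV. (v $ j) ^ Poly_Mapping.lookup \<alpha> j)) \<in> J" for \<alpha> c
  proof -
    have "(\<Prod>j\<in>UNIV. var_poly j ^ Poly_Mapping.lookup \<alpha> j) -
        (\<Prod>j\<in>UNIV. const_poly (v $ j) ^ Poly_Mapping.lookup \<alpha> j) \<in> J"
      by (intro ideal_prod_diff ideal_power_diff J v)
    from ideal_set_mult[OF J this, of "const_poly c"] show ?thesis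
      by (simp add: monomial_eq_prod_var_poly const_poly_mult const_poly_prod const_poly_power
          right_diff_distrib)
  qed
  have "p - const_poly (eval_poly p v) =
     (\<Sum>\<alpha>\<in>Poly_Mapping.keys p. Poly_Mapping.single \<alpha> (Poly_Mapping.lookup p \<alpha>) -
        const_poly (Poly_Mapping.lookup p \<alpha> * (\<Prod>j\<in>UNIV. (v $ j) ^ Poly_Mapping.lookup \<alpha> j)))"
    by (simp add: sum_subtractf const_poly_sum eval_poly_def flip: poly_mapping_eq_sum_single)
  also have "\<dots> \<in> J"
    by (intro ideal_set_sum J mono)
  finally show ?thesis .
qed

text \<open>The factors are multiplied onto \<open>x\<close> one by one; \<open>h\<close> is the
  partial product just before the result enters \<open>J\<close>.\<close>

lemma prod_in_ideal_obtain_factor: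
  assumes fin: "finite V" and prod: "(\<Prod>v\<in>V. a v) * x \<in> J" and x: "x \<notin> J"
  obtains v h where "v \<in> V" "a v * (h * x) \<in> J" "h * x \<notin> J"
proof -
  have "\<exists>v\<in>V. \<exists>h. a v * (h * x) \<in> J \<and> h * x \<notin> J"
    using fin prod
  proof (induction V rule: finite_induct)
    case (insert v V)
    show ?case
    proof (cases "(\<Prod>v\<in>V. a v) * x \<in> J")
      case False
      with insert.prems insert.hyps show ?thesis
        by (intro bexI[of _ v] exI[of _ "\<Prod>v\<in>V. a v"]) (auto simp: mult.assoc)
    qed (use insert in auto)
  qed (use x in auto)
  with that show ?thesis
    by blast
qed

text \<open>Iterating the colon construction: a proper ideal \<open>(J : x)\<close> containing several products can
  be enlarged to a proper ideal \<open>(J : h x)\<close> containing one factor of each product.\<close>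

lemma prods_in_ideal_obtain_factors:
  assumes fin: "finite V" and J: "ideal_set J"
    and \<Psi>: "finite \<Psi>" "\<And>\<phi>. \<phi> \<in> \<Psi> \<Longrightarrow> (\<Prod>v\<in>V. a \<phi> v) \<in> J" and x: "x \<notin> J"
  obtains \<sigma> h where "\<sigma> ` \<Psi> \<subseteq> V" "\<And>\<phi>. \<phi> \<in> \<Psi> \<Longrightarrow> a \<phi> (\<sigma> \<phi>) * (h * x) \<in> J" "h * x \<notin> J"
proof -
  have "\<exists>\<sigma> h. \<sigma> ` \<Psi> \<subseteq> V \<and> (\<forall>\<phi>\<in>\<Psi>. a \<phi> (\<sigma> \<phi>) * (h * x) \<in> J) \<and> h * x \<notin> J"
    using \<Psi>
  proof (induction \<Psi> rule: finite_induct)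
    case empty
    then show ?case
      using x by (auto intro!: exI[of _ 1])
  next
    case (insert \<phi> \<Psi>)
    then obtain \<sigma> h where \<sigma>: "\<sigma> ` \<Psi> \<subseteq> V" "\<forall>\<psi>\<in>\<Psi>. a \<psi> (\<sigma> \<psi>) * (h * x) \<in> J" "h * x \<notin> J"
      by (metis insertCI)
    have "(\<Prod>v\<in>V. a \<phi> v) * (h * x) \<in> J"
      using ideal_set_mult[OF J insert.prems, of \<phi> "h * x"] by (simp add: mult.commute)
    then obtain v k where v: "v \<in> V" "a \<phi> v * (k * (h * x)) \<in> J" "k * (h * x) \<notin> J"
      using prod_in_ideal_obtain_factor[OF fin] \<sigma>(3) by metis
    have "a \<psi> (\<sigma> \<psi>) * (k * h * x) \<in> J" if "\<psi> \<in> \<Psi>" for \<psi>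
      using ideal_set_mult[OF J \<sigma>(2)[rule_format, OF that], of k] by (simp add: mult_ac)
    then show ?case
      using v \<sigma>(1) insert.hyps
      by (intro exI[of _ "\<sigma>(\<phi> := v)"] exI[of _ "k * h"]) (auto simp: mult.assoc)
  qed
  with that show ?thesis
    by metis
qed

section \<open>Multiplicities\<close>

definition local_maximal_ideal :: "(complex, 'n::{finite,linorder}) vec \<Rightarrow> 'n cpoly fract set" where
  "local_maximal_ideal z = {Fract p q | p q. eval_poly p z = 0 \<and> eval_poly q z \<noteq> 0}"

lemma local_maximal_ideal_add:
  assumes "x \<in> local_maximal_ideal z" "y \<in> local_maximal_ideal z"
  shows "x + y \<in> local_maximal_ideal z"
proof -
  obtain p q p' q' where x: "x = Fract p q" "eval_poly p z = 0" "eval_poly q z \<noteq> 0"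
    and y: "y = Fract p' q'" "eval_poly p' z = 0" "eval_poly q' z \<noteq> 0"
    using assms by (auto simp: local_maximal_ideal_def)
  then have "q \<noteq> 0" "q' \<noteq> 0"
    by auto
  then have "x + y = Fract (p * q' + p' * q) (q * q')"
    by (simp add: x y)
  with x y show ?thesis
    unfolding local_maximal_ideal_def by fastforce
qed

lemma local_ideal_subset_maximal:
  assumes "z \<in> solution_set f"
  shows "local_ideal f z \<subseteq> local_maximal_ideal z"
proof
  fix x assume "x \<in> local_ideal f z"
  then obtain r where x: "x = (\<Sum>i\<in>UNIV. r i * Fract (f i) 1)" and r: "\<And>i. r i \<in> local_ring z"
    by (auto simp: local_ideal_def)
  have r': "r i * Fract (f i) 1 \<in> local_maximal_ideal z" for i
  proof -
    obtain p q where "r i = Fract p q" "eval_poly q z \<noteq> 0"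
      using r[of i] by (auto simp: local_ring_def)
    with assms have "r i * Fract (f i) 1 = Fract (p * f i) q" "eval_poly (p * f i) z = 0"
      by (auto simp: solution_set_def)
    with \<open>eval_poly q z \<noteq> 0\<close> show ?thesis
      unfolding local_maximal_ideal_def by blast
  qed
  have "0 = Fract (0 :: 'a cpoly) 1 \<and> eval_poly 0 z = 0 \<and> eval_poly 1 z \<noteq> 0"
    by (simp add: Zero_fract_def)
  then have "0 \<in> local_maximal_ideal z"
    unfolding local_maximal_ideal_def by blast
  then have "(\<Sum>i\<in>A. r i * Fract (f i) 1) \<in> local_maximal_ideal z" for A
    by (induction A rule: infinite_finite_induct) (auto intro: local_maximal_ideal_add r')
  then show "x \<in> local_maximal_ideal z"
    by (simp add: x)
qed

lemma one_notin_local_maximal_ideal: "1 \<notin> local_maximal_ideal z"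
proof
  assume "1 \<in> local_maximal_ideal z"
  then obtain p q where pq: "Fract 1 1 = Fract p q" "eval_poly p z = 0" "eval_poly q z \<noteq> 0"
    by (auto simp: local_maximal_ideal_def One_fract_def)
  then have "q \<noteq> 0"
    by auto
  with pq have "p = q"
    by (simp add: eq_fract)
  with pq show False
    by simp
qed

text \<open>An empty spanning set would put \<open>1\<close> into \<open>local_ideal f z\<close>,
  hence into the maximal ideal.\<close>

lemma multiplicity_at_ge_1:
  assumes "z \<in> solution_set f"
  shows "1 \<le> multiplicity_at f z"
  unfolding multiplicity_at_def
proof (rule INF_greatest)
  fix B assume B: "B \<in> {B. finite B \<and> B \<subseteq> local_ring z \<and>
                (\<forall>r\<in>local_ring z. \<exists>c. 
                   r - (\<Sum>b\<in>B. Fract (Poly_Mapping.single 0 (c b)) 1 * b) \<in> local_ideal f z)}"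
  have "B \<noteq> {}"
  proof
    assume "B = {}"
    moreover have "1 \<in> local_ring z"
      by (auto simp: local_ring_def One_fract_def intro!: exI[of _ 1])
    ultimately have "1 \<in> local_ideal f z"
      using B by force
    then show False
      using local_ideal_subset_maximal[OF assms] one_notin_local_maximal_ideal by blast
  qed
  with B have "1 \<le> card B"
    by (simp add: Suc_leI card_gt_0_iff)
  then show "1 \<le> enat (card B)"
    by (simp add: one_enat_def)
qed

lemma generic_system_card_le:
  assumes "generic_system f"
  shows "finite (solution_set f)"
    and "real (card (solution_set f)) \<le> mixed_volume (\<lambda>i. newton_polytope (f i))"
proof -
  show fin: "finite (solution_set f)"
    using assms by (simp add: generic_system_def)
  \<comment> \<open>The comparison is made in \<open>ereal\<close> because multiplicities are
    extended numbers, a priori possibly infinite.\<close>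
  have "ereal (real (card (solution_set f))) = (\<Sum>z\<in>solution_set f. ereal 1)"
    unfolding sum_ereal by simp
  also have "\<dots> \<le> (\<Sum>z\<in>solution_set f. ereal_of_enat (multiplicity_at f z))"
  proof (intro sum_mono)
    fix z assume "z \<in> solution_set f"
    then have "ereal_of_enat (enat 1) \<le> ereal_of_enat (multiplicity_at f z)"
      using multiplicity_at_ge_1 unfolding ereal_of_enat_le_iff one_enat_def by blast
    then show "ereal 1 \<le> ereal_of_enat (multiplicity_at f z)"
      by simp
  qed
  also have "\<dots> = ereal (mixed_volume (\<lambda>i. newton_polytope (f i)))"
    using assms by (simp add: generic_system_def)
  finally show "real (card (solution_set f)) \<le> mixed_volume (\<lambda>i. newton_polytope (f i))"
    by simp
qed

section \<open>Affine forms\<close>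

text \<open>Homogeneous coordinates in the chart where the coordinate \<open>None\<close> is
  \<open>1\<close>; the index type has n + 1 elements.\<close>

definition hcoord :: "complex ^ 'n \<Rightarrow> 'n option \<Rightarrow> complex" where
  "hcoord z j = (case j of None \<Rightarrow> 1 | Some i \<Rightarrow> z $ i)"

text \<open>Affine forms are represented by coefficient vectors, so that span and dimension in
  \<open>complex ^ 'n option\<close> apply to them.\<close>

definition form_eval :: "complex ^ 'n::finite option \<Rightarrow> complex ^ 'n \<Rightarrow> complex" where
  "form_eval c z = (\<Sum>j\<in>UNIV. c $ j * hcoord z j)"

definition form_poly :: "complex ^ 'n::finite option \<Rightarrow> 'n cpoly" where
  "form_poly c = const_poly (c $ None) + (\<Sum>i\<in>UNIV. const_poly (c $ Some i) * var_poly i)"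

lemma hcoord_simps [simp]: "hcoord z None = 1" "hcoord z (Some i) = z $ i"
  by (simp_all add: hcoord_def)

lemma hcoord_nonzero: "z \<in> torus \<Longrightarrow> hcoord z j \<noteq> 0"
  by (cases j) (auto simp: torus_def)

lemma sum_UNIV_option:
  "(\<Sum>j\<in>UNIV. f j) = f None + (\<Sum>i\<in>(UNIV :: 'n::finite set). f (Some i))"
  by (simp add: UNIV_option_conv sum.reindex)

lemma eval_form_poly [simp]: "eval_poly (form_poly c) z = form_eval c z"
  by (simp add: form_poly_def form_eval_def sum_UNIV_option)

lemma form_poly_zero [simp]: "form_poly 0 = 0"
  by (simp add: form_poly_def)

lemma form_poly_add: "form_poly (x + y) = form_poly x + form_poly y"
  by (simp add: form_poly_def const_poly_add sum.distrib algebra_simps)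

lemma form_poly_scale: "form_poly (a *s x) = const_poly a * form_poly x"
  by (simp add: form_poly_def const_poly_mult sum_distrib_left algebra_simps)

lemma form_poly_axis_None: "form_poly (axis None 1) = 1"
  by (simp add: form_poly_def axis_def)

lemma form_poly_axis_Some: "form_poly (axis (Some i) 1) = var_poly i"
proof -
  have "(\<Sum>k\<in>UNIV. const_poly (axis (Some i) 1 $ Some k) * var_poly k) = (\<Sum>k\<in>UNIV. if k = i then var_poly i else 0)"
    by (intro sum.cong) (auto simp: axis_def)
  then show ?thesis
    by (simp add: form_poly_def) (simp add: axis_def)
qed

lemma total_degree_form_poly_le: "total_degree (form_poly c) \<le> 1"
  unfolding total_degree_le_iff
proof
  fix \<alpha> assume "\<alpha> \<in> Poly_Mapping.keys (form_poly c)"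
  moreover have "form_poly c = Poly_Mapping.single 0 (c $ None) +
      (\<Sum>i\<in>UNIV. Poly_Mapping.single (Poly_Mapping.single i 1) (c $ Some i))"
    by (simp add: form_poly_def const_poly_def var_poly_def mult_single)
  ultimately have "Poly_Mapping.lookup (Poly_Mapping.single 0 (c $ None) +
      (\<Sum>i\<in>UNIV. Poly_Mapping.single (Poly_Mapping.single i 1) (c $ Some i))) \<alpha> \<noteq> 0"
    by (simp add: in_keys_iff)
  then have "Poly_Mapping.lookup (Poly_Mapping.single 0 (c $ None)) \<alpha> \<noteq> 0 \<or>
      (\<Sum>i\<in>UNIV. Poly_Mapping.lookup (Poly_Mapping.single (Poly_Mapping.single i 1) (c $ Some i)) \<alpha>) \<noteq> 0"
    by (auto simp: lookup_add lookup_sum)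
  then have "Poly_Mapping.lookup (Poly_Mapping.single 0 (c $ None)) \<alpha> \<noteq> 0 \<or>
      (\<exists>i. Poly_Mapping.lookup (Poly_Mapping.single (Poly_Mapping.single i 1) (c $ Some i)) \<alpha> \<noteq> 0)"
    by (meson sum.neutral)
  then have "\<alpha> = 0 \<or> (\<exists>i. \<alpha> = Poly_Mapping.single i 1)"
    by (auto simp: lookup_single when_def split: if_splits)
  then show "(\<Sum>j\<in>UNIV. Poly_Mapping.lookup \<alpha> j) \<le> 1"
    by (auto simp: lookup_single when_def)
qed

section \<open>Duality for coefficient vectors, and ideals containing affine forms\<close>

lemma sum_axis_mult: "(\<Sum>j\<in>UNIV. axis k 1 $ j * Z j) = (Z k :: complex)" for k :: "'m::finite"
proof -
  have "(\<Sum>j\<in>UNIV. axis k 1 $ j * Z j) = (\<Sum>j\<in>UNIV. if j = k then Z k else 0)"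
    by (intro sum.cong) (auto simp: axis_def)
  then show ?thesis
    by simp
qed

text \<open>Double annihilator: if \<open>x\<close> were outside the span, some linear functional
  would be \<open>1\<close> at \<open>x\<close> and \<open>0\<close> on a basis of the span.\<close>

lemma in_span_if_annihilator_le:
  fixes S :: "('a::field ^ 'm::finite) set"
  assumes ann: "\<And>Z. (\<And>s. s \<in> S \<Longrightarrow> (\<Sum>j\<in>UNIV. s $ j * Z j) = 0) \<Longrightarrow> (\<Sum>j\<in>UNIV. x $ j * Z j) = 0"
  shows "x \<in> vec.span S"
proof (rule ccontr)
  interpret vector_space_pair "(*s) :: 'a \<Rightarrow> 'a ^ 'm \<Rightarrow> 'a ^ 'm" "(*) :: 'a \<Rightarrow> 'a \<Rightarrow> 'a"
    by unfold_locales (auto simp: algebra_simps)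
  assume x: "x \<notin> vec.span S"
  obtain B where B: "B \<subseteq> S" "vec.independent B" "S \<subseteq> vec.span B"
    using vec.maximal_independent_subset by metis
  with x have "x \<notin> vec.span B"
    using vec.span_mono by blast
  then have "vec.independent (insert x B)"
    using B(2) by (rule vec.independent_insertI)
  then obtain g where g: "Vector_Spaces.linear (*s) (*) g"
    and gB: "\<And>b. b \<in> insert x B \<Longrightarrow> g b = (if b = x then 1 else 0)"
    using linear_independent_extend[of "insert x B" "\<lambda>b. if b = x then 1 else 0"] by blast
  \<comment> \<open>A functional is determined by its values on the axis vectors; these values are
    the \<open>Z\<close> fed to \<open>ann\<close>.\<close>
  have g_sum: "g y = (\<Sum>j\<in>UNIV. y $ j * g (axis j 1))" for y
  proof -
    have "g y = g (\<Sum>j\<in>UNIV. (y $ j) *s axis j 1)"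
      by (simp only: basis_expansion)
    then show ?thesis
      by (simp add: linear_sum[OF g] linear_scale[OF g])
  qed
  have "g b = 0" if "b \<in> B" for b
    using gB[of b] that \<open>x \<notin> vec.span B\<close> vec.span_base by force
  then have "g s = 0" if "s \<in> S" for s
    using linear_eq_0_on_span[OF g, of B s] that B(3) by blast
  then have "(\<Sum>j\<in>UNIV. x $ j * g (axis j 1)) = 0"
    using ann[of "\<lambda>j. g (axis j 1)"] by (simp flip: g_sum)
  then show False
    using gB[of x] by (simp flip: g_sum)
qed

lemma form_poly_span_in_ideal:
  assumes J: "ideal_set J" and S: "\<And>s. s \<in> S \<Longrightarrow> form_poly s \<in> J" and x: "x \<in> vec.span S"
  shows "form_poly x \<in> J"
  using x
proof (induction rule: vec.span_induct_alt)
  case base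
  then show ?case
    by (simp add: ideal_set_0[OF J])
next
  case (step c s y)
  then show ?case
    by (auto simp: form_poly_add form_poly_scale intro!: ideal_set_add[OF J] ideal_set_mult[OF J] S)
qed

lemma sum_UNIV_option_homogeneous:
  assumes "Z None \<noteq> 0"
  shows "(\<Sum>j\<in>UNIV. c $ j * Z j) = Z None * form_eval c (\<chi> i. Z (Some i) / Z None)"
  using assms by (simp add: form_eval_def sum_UNIV_option sum_distrib_left algebra_simps)

text \<open>A linear Nullstellensatz: without an affine common zero all homogeneous solutions lie at
  infinity, where the constant form \<open>1\<close> vanishes too, so duality puts it into the
  span.\<close>

lemma one_in_ideal_if_no_common_zero:
  assumes J: "ideal_set J" and S: "\<And>s. s \<in> S \<Longrightarrow> form_poly s \<in> J"
    and no: "\<nexists>P. \<forall>s\<in>S. form_eval s P = 0"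
  shows "1 \<in> J"
proof -
  have "axis None 1 \<in> vec.span S"
  proof (rule in_span_if_annihilator_le)
    fix Z assume Z: "\<And>s. s \<in> S \<Longrightarrow> (\<Sum>j\<in>UNIV. s $ j * Z j) = 0"
    have "Z None = 0"
    proof (rule ccontr)
      assume "Z None \<noteq> 0"
      then have "\<forall>s\<in>S. form_eval s (\<chi> i. Z (Some i) / Z None) = 0"
        using Z sum_UNIV_option_homogeneous[of Z] by simp
      with no show False
        by blast
    qed
    then show "(\<Sum>j\<in>UNIV. axis None 1 $ j * Z j) = 0"
      by (simp add: sum_axis_mult)
  qed
  from form_poly_span_in_ideal[OF J S this] show ?thesis
    by (simp add: form_poly_axis_None)
qed

text \<open>Duality again, for the forms \<open>var_poly i - const_poly (P $ i)\<close>: all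
  homogeneous solutions are multiples of the one given by \<open>P\<close>.\<close>

lemma maximal_ideal_subset_if_unique_common_zero:
  assumes J: "ideal_set J" and S: "\<And>s. s \<in> S \<Longrightarrow> form_poly s \<in> J"
    and P: "\<And>s. s \<in> S \<Longrightarrow> form_eval s P = 0"
    and unique: "\<And>Q. (\<And>s. s \<in> S \<Longrightarrow> form_eval s Q = 0) \<Longrightarrow> Q = P"
  shows "p - const_poly (eval_poly p P) \<in> J"
proof (rule poly_minus_eval_in_ideal[OF J])
  fix i
  have "axis (Some i) 1 + (- (P $ i)) *s axis None 1 \<in> vec.span S" (is "?x \<in> _")
  proof (rule in_span_if_annihilator_le)
    fix Z assume Z: "\<And>s. s \<in> S \<Longrightarrow> (\<Sum>j\<in>UNIV. s $ j * Z j) = 0"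
    have "Z (Some i) = P $ i * Z None"
    proof (cases "Z None = 0")
      case True
      \<comment> \<open>Translating \<open>P\<close> by a solution at infinity gives another common
        zero, so the translation is zero.\<close>
      have "form_eval s (\<chi> i. P $ i + Z (Some i)) = 0" if "s \<in> S" for s
        using Z[OF that] P[OF that] True
        by (simp add: form_eval_def sum_UNIV_option sum.distrib distrib_left flip: add.assoc)
      then have "(\<chi> i. P $ i + Z (Some i)) = P"
        by (rule unique)
      then have "(\<chi> i. P $ i + Z (Some i)) $ i = P $ i"
        by simp
      with True show ?thesis
        by simp
    next
      case False
      then have "(\<chi> i. Z (Some i) / Z None) = P"
        using Z sum_UNIV_option_homogeneous[of Z] by (intro unique) simp
      then have "(\<chi> i. Z (Some i) / Z None) $ i = P $ i"
        by simp
      with False show ?thesis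
        by (simp add: field_simps)
    qed
    then show "(\<Sum>j\<in>UNIV. ?x $ j * Z j) = 0"
      by (simp add: left_diff_distrib sum_subtractf mult.assoc sum_axis_mult flip: sum_distrib_left)
  qed
  from form_poly_span_in_ideal[OF J S this]
  have "var_poly i + const_poly (- (P $ i)) \<in> J"
    unfolding form_poly_add form_poly_scale form_poly_axis_None form_poly_axis_Some by simp
  then show "var_poly i - const_poly (P $ i) \<in> J"
    by (simp add: const_poly_def single_uminus)
qed

text \<open>If a vanishing \<open>f\<close> were outside the generated ideal J, a proper colon ideal
  (J : h f) would contain one factor of every product. These factors have a common zero
  \<open>P\<close>, which by \<open>common\<close> is the centre of all of them. The colon ideal
  then contains the maximal ideal of \<open>P\<close> and also an element nonzero at
  \<open>P\<close>, hence \<open>1\<close>.\<close>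

lemma span_prod_forms_eq_vanishing_ideal:
  fixes V :: "(complex ^ 'n::finite) set" and c :: "'b \<Rightarrow> complex ^ 'n \<Rightarrow> complex ^ 'n option"
  assumes fin: "finite V" "finite \<Psi>" and ne: "\<Psi> \<noteq> {}"
    and zero: "\<And>\<phi> v. \<lbrakk>\<phi> \<in> \<Psi>; v \<in> V\<rbrakk> \<Longrightarrow> form_eval (c \<phi> v) v = 0"
    and nonzero: "\<And>\<phi> u v. \<lbrakk>\<phi> \<in> \<Psi>; u \<in> V; v \<in> V; u \<noteq> v\<rbrakk> \<Longrightarrow> form_eval (c \<phi> u) v \<noteq> 0"
    and common: "\<And>\<sigma> P \<phi>. \<lbrakk>\<sigma> ` \<Psi> \<subseteq> V; \<forall>\<psi>\<in>\<Psi>. form_eval (c \<psi> (\<sigma> \<psi>)) P = 0; \<phi> \<in> \<Psi>\<rbrakk> \<Longrightarrow> \<sigma> \<phi> = P"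
  shows "module.span (*) ((\<lambda>\<phi>. \<Prod>v\<in>V. form_poly (c \<phi> v)) ` \<Psi>) = vanishing_ideal V"
proof (rule subset_antisym)
  define g where "g \<phi> = (\<Prod>v\<in>V. form_poly (c \<phi> v))" for \<phi>
  let ?J = "module.span (*) (g ` \<Psi>)"
  have J: "ideal_set ?J"
    by (rule module.subspace_span[OF module_mult])
  have gJ: "g \<phi> \<in> ?J" if "\<phi> \<in> \<Psi>" for \<phi>
    using that by (intro module.span_base[OF module_mult]) auto
  have "g \<phi> \<in> vanishing_ideal V" if "\<phi> \<in> \<Psi>" for \<phi>
    using zero[OF that] fin(1) unfolding vanishing_ideal_def g_def by auto
  then show "module.span (*) ((\<lambda>\<phi>. \<Prod>v\<in>V. form_poly (c \<phi> v)) ` \<Psi>) \<subseteq> vanishing_ideal V"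
    by (intro module.span_minimal[OF module_mult] ideal_set_vanishing_ideal) (auto simp: g_def)
  show "vanishing_ideal V \<subseteq> module.span (*) ((\<lambda>\<phi>. \<Prod>v\<in>V. form_poly (c \<phi> v)) ` \<Psi>)"
  proof
    fix f assume f: "f \<in> vanishing_ideal V"
    have "f \<in> ?J"
    proof (rule ccontr)
      assume "f \<notin> ?J"
      then obtain \<sigma> h where \<sigma>: "\<sigma> ` \<Psi> \<subseteq> V"
        and \<sigma>J: "\<And>\<phi>. \<phi> \<in> \<Psi> \<Longrightarrow> form_poly (c \<phi> (\<sigma> \<phi>)) * (h * f) \<in> ?J" and hf: "h * f \<notin> ?J"
        using prods_in_ideal_obtain_factors[OF fin(1) J fin(2), of "\<lambda>\<phi> v. form_poly (c \<phi> v)" f] gJ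
        unfolding g_def by blast
      define K where "K = {x. x * (h * f) \<in> ?J}"
      have K: "ideal_set K"
        unfolding K_def by (rule ideal_set_colon[OF J])
      have 1: "1 \<notin> K"
        using hf by (simp add: K_def)
      let ?S = "(\<lambda>\<phi>. c \<phi> (\<sigma> \<phi>)) ` \<Psi>"
      have SK: "form_poly s \<in> K" if "s \<in> ?S" for s
        using that \<sigma>J by (auto simp: K_def)
      obtain P where P: "\<forall>s\<in>?S. form_eval s P = 0"
        using one_in_ideal_if_no_common_zero[OF K SK] 1 by blast
      have \<sigma>P: "\<sigma> \<phi> = P" if "\<phi> \<in> \<Psi>" for \<phi>
        using common[OF \<sigma> _ that] P by auto
      with \<sigma> ne have PV: "P \<in> V"
        by auto
      have unique: "Q = P" if "\<And>s. s \<in> ?S \<Longrightarrow> form_eval s Q = 0" for Q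
        using common[OF \<sigma>, of Q] that \<sigma>P ne by auto
      \<comment> \<open>The product of all factors not centred at \<open>P\<close>: it is nonzero at
        \<open>P\<close> and turns any chosen form centred at \<open>P\<close> into a multiple of a
        generator.\<close>
      define s where "s = (\<Prod>\<phi>\<in>\<Psi>. \<Prod>u\<in>V - {P}. form_poly (c \<phi> u))"
      have sP: "eval_poly s P \<noteq> 0"
        using nonzero PV fin by (auto simp: s_def)
      let ?K' = "{x. x * s \<in> ?J}"
      have K': "ideal_set ?K'"
        by (rule ideal_set_colon[OF J])
      have "form_poly t \<in> ?K'" if "t \<in> ?S" for t
      proof -
        obtain \<phi> where \<phi>: "\<phi> \<in> \<Psi>" "t = c \<phi> P"
          using \<open>t \<in> ?S\<close> \<sigma>P by auto
        have "form_poly t * s =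
            (\<Prod>\<psi>\<in>\<Psi> - {\<phi>}. \<Prod>u\<in>V - {P}. form_poly (c \<psi> u)) * g \<phi>"
          using fin \<phi> PV by (simp add: s_def g_def prod.remove[of \<Psi> \<phi>] prod.remove[of V P] mult_ac)
        with gJ[OF \<phi>(1)] show ?thesis
          by (simp add: ideal_set_mult[OF J])
      qed
      \<comment> \<open>The ideal (J : s) contains the maximal ideal of \<open>P\<close> as well,
        and \<open>f\<close> vanishes at \<open>P\<close>.\<close>
      then have "f - const_poly (eval_poly f P) \<in> ?K'"
        using maximal_ideal_subset_if_unique_common_zero[OF K' _ _ unique] P by blast
      then have "f * s \<in> ?J"
        using f PV by (simp add: vanishing_ideal_def)
      from ideal_set_mult[OF J this, of h] have "s \<in> K"
        by (simp add: K_def mult_ac)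
      moreover have "s - const_poly (eval_poly s P) \<in> K"
        using maximal_ideal_subset_if_unique_common_zero[OF K SK _ unique] P by blast
      ultimately have "const_poly (eval_poly s P) \<in> K"
        using ideal_set_diff[OF K, of s "s - const_poly (eval_poly s P)"] by simp
      from ideal_set_mult[OF K this, of "const_poly (1 / eval_poly s P)"] have "1 \<in> K"
        using sP by (simp flip: const_poly_mult)
      with 1 show False ..
    qed
    then show "f \<in> module.span (*) ((\<lambda>\<phi>. \<Prod>v\<in>V. form_poly (c \<phi> v)) ` \<Psi>)"
      by (simp add: g_def[abs_def])
  qed
qed

section \<open>Weighted affine forms centred at a point of the torus\<close>

text \<open>The affine form \<open>\<Sum>\<^sub>j w\<^sub>j (Y\<^sub>j - Y\<^sub>i)\<close> in the homogeneous coordinates \<open>Y\<^sub>j = z\<^sub>j / v\<^sub>j\<close> centred at \<open>v\<close>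
  (with \<open>Y\<^sub>0 = 1\<close>, the index \<open>0\<close> being \<open>None\<close>).\<close>

definition wform :: "('n option \<Rightarrow> real) \<Rightarrow> complex ^ 'n::finite \<Rightarrow> 'n option \<Rightarrow> complex ^ 'n option" where
  "wform w v i = (\<chi> j. of_real (w j - (if j = i then \<Sum>k\<in>UNIV. w k else 0)) / hcoord v j)"

lemma form_eval_wform:
  "form_eval (wform w v i) z =
    (\<Sum>j\<in>UNIV. of_real (w j) * (hcoord z j / hcoord v j - hcoord z i / hcoord v i))"
proof -
  let ?Y = "\<lambda>j. hcoord z j / hcoord v j"
  have "form_eval (wform w v i) z =
      (\<Sum>j\<in>UNIV. of_real (w j) * ?Y j - (if j = i then of_real (\<Sum>k\<in>UNIV. w k) * ?Y i else 0))"
    unfolding form_eval_def wform_def by (intro sum.cong) (auto simp: algebra_simps diff_divide_distrib)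
  also have "\<dots> = (\<Sum>j\<in>UNIV. of_real (w j) * ?Y j) - of_real (\<Sum>k\<in>UNIV. w k) * ?Y i"
    by (simp add: sum_subtractf)
  also have "\<dots> = (\<Sum>j\<in>UNIV. of_real (w j) * (?Y j - ?Y i))"
    by (simp add: right_diff_distrib sum_subtractf sum_distrib_right sum_divide_distrib)
  finally show ?thesis .
qed

lemma hcoord_ratio_const_imp_eq:
  assumes "v \<in> torus" "\<And>j. hcoord z j / hcoord v j = r"
  shows "z = v"
proof -
  have "r = 1"
    using assms(2)[of None] by simp
  then have "z $ k = v $ k" for k
    using assms(2)[of "Some k"] assms(1) by (simp add: torus_def)
  then show ?thesis
    by (simp add: vec_eq_iff)
qed

lemma form_eval_wform_self [simp]:
  assumes "v \<in> torus"
  shows "form_eval (wform w v i) v = 0"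
  using hcoord_nonzero[OF assms] by (simp add: form_eval_wform)

text \<open>A weighted mean of numbers in a disc centred at \<open>0\<close> lies on the bounding circle only if all of
  them coincide.\<close>

lemma wform_zero_imp_eq:
  assumes w: "\<And>j. w j > 0" and v: "v \<in> torus" and z: "z \<in> torus"
    and max: "\<And>j. cmod (hcoord z j / hcoord v j) \<le> cmod (hcoord z i / hcoord v i)"
    and zero: "form_eval (wform w v i) z = 0"
  shows "z = v"
proof (rule hcoord_ratio_const_imp_eq[OF v])
  let ?Y = "\<lambda>j. hcoord z j / hcoord v j"
  define u where "u j = ?Y j / ?Y i" for j
  have Yi: "?Y i \<noteq> 0"
    using hcoord_nonzero v z by auto
  have u: "cmod (u j) \<le> 1" for j
    unfolding u_def norm_divide[of "?Y j"]
    using max[of j] Yi by (metis divide_le_eq_1_pos zero_less_norm_iff)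
  have "(\<Sum>j\<in>UNIV. of_real (w j) * (?Y j - ?Y i)) = ?Y i * (\<Sum>j\<in>UNIV. of_real (w j) * (u j - 1))"
    using Yi unfolding sum_distrib_left u_def by (intro sum.cong) (auto simp: right_diff_distrib)
  with zero Yi have "(\<Sum>j\<in>UNIV. of_real (w j) * (u j - 1)) = 0"
    by (simp add: form_eval_wform)
  \<comment> \<open>Up to sign, the real part is a sum of nonnegative terms, so all of them
    vanish.\<close>
  then have "Re (\<Sum>j\<in>UNIV. of_real (w j) * (u j - 1)) = 0"
    by simp
  then have "(\<Sum>j\<in>UNIV. w j * (1 - Re (u j))) = 0"
    by (simp add: right_diff_distrib sum_subtractf)
  moreover have "0 \<le> w j * (1 - Re (u j))" for j
    using w[of j] complex_Re_le_cmod[of "u j"] u[of j] by (intro mult_nonneg_nonneg) auto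
  ultimately have "w j * (1 - Re (u j)) = 0" for j
    by (subst (asm) sum_nonneg_eq_0_iff) auto
  then have Re: "Re (u j) = 1" for j
    using w[of j] by (metis less_irrefl mult_eq_0_iff right_minus_eq)
  have "u j = 1" for j
  proof -
    have "(cmod (u j))\<^sup>2 \<le> 1"
      using u[of j] by (simp add: power_le_one)
    then have "Im (u j) = 0"
      using Re[of j] by (simp add: cmod_power2)
    with Re[of j] show ?thesis
      by (simp add: complex_eq_iff)
  qed
  then show "?Y j = ?Y i" for j
    using Yi by (metis divide_eq_1_iff u_def)
qed

text \<open>The weights are powers of one parameter \<open>t\<close>. For each \<open>Q\<close> the
  value of the form is then a nonzero polynomial in \<open>t\<close>, so only finitely many
  \<open>t\<close> must be avoided.\<close>

lemma positive_weights_avoiding: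
  fixes v :: "complex ^ 'n::finite"
  assumes F: "finite F" "v \<notin> F" and v: "v \<in> torus"
  obtains w where "\<And>j. w j > 0" "\<And>Q. Q \<in> F \<Longrightarrow> form_eval (wform w v i) Q \<noteq> 0"
proof -
  obtain idx :: "'n option \<Rightarrow> nat" where idx: "inj idx"
    using finite_imp_inj_to_nat_seg[of "UNIV :: 'n option set"] by auto
  define b where "b Q j = hcoord Q j / hcoord v j - hcoord Q i / hcoord v i" for Q j
  define p where "p Q = (\<Sum>j\<in>UNIV. monom (b Q j) (idx j))" for Q
  have p: "p Q \<noteq> 0" if "Q \<in> F" for Q
  proof -
    have "Q \<noteq> v"
      using that F by auto
    then obtain j where j: "b Q j \<noteq> 0"
      using hcoord_ratio_const_imp_eq[OF v] unfolding b_def by (metis right_minus_eq)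
    \<comment> \<open>Distinct exponents \<open>idx j\<close> keep the coefficients
      \<open>b Q j\<close> from mixing.\<close>
    have "coeff (p Q) (idx j) = (\<Sum>k\<in>UNIV. if k = j then b Q k else 0)"
      unfolding p_def coeff_sum by (intro sum.cong) (auto simp: inj_eq[OF idx])
    with j show ?thesis
      by auto
  qed
  have "finite (of_real -` (\<Union>Q\<in>F. {x. poly (p Q) x = 0}) :: real set)"
    using F p by (intro finite_vimageI finite_UN_I poly_roots_finite) (auto simp: inj_def)
  then obtain t :: real where t: "t > 0" "t \<notin> of_real -` (\<Union>Q\<in>F. {x. poly (p Q) x = 0})"
    using infinite_Ioi[of "0 :: real"] by (metis greaterThan_iff rev_finite_subset subsetI)
  have eval: "form_eval (wform (\<lambda>j. t ^ idx j) v i) Q = poly (p Q) (of_real t)" for Q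
    unfolding form_eval_wform p_def b_def poly_sum by (simp add: poly_monom mult.commute)
  show thesis
    by (rule that[of "\<lambda>j. t ^ idx j"]) (use t in \<open>auto simp: eval\<close>)
qed

lemma form_eval_span_eq_0:
  assumes "\<And>s. s \<in> S \<Longrightarrow> form_eval s Q = 0" "x \<in> vec.span S"
  shows "form_eval x Q = 0"
  using assms(2)
proof (induction rule: vec.span_induct_alt)
  case base
  then show ?case
    by (simp add: form_eval_def)
next
  case (step c s t)
  moreover have "form_eval (c *s s + t) Q = c * form_eval s Q + form_eval t Q"
    by (simp add: form_eval_def sum.distrib sum_distrib_left algebra_simps)
  ultimately show ?case
    using assms(1) by simp
qed

text \<open>Weights are chosen greedily: whenever some earlier forms have a common zero other than \<open>v\<close>, the
  next form centred at \<open>v\<close> must be nonzero at one such point, hence is independent of these forms.\<close>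

lemma generic_weights:
  fixes V :: "(complex ^ 'n::finite) set" and \<Phi> :: "(complex ^ 'n \<Rightarrow> 'n option) set"
  assumes V: "finite V" "V \<subseteq> torus" and \<Phi>: "finite \<Phi>"
  shows "\<exists>w. (\<forall>\<phi>\<in>\<Phi>. \<forall>v\<in>V. \<forall>j. w \<phi> v j > 0) \<and>
    (\<forall>\<phi>\<in>\<Phi>. \<forall>u\<in>V. \<forall>v\<in>V. u \<noteq> v \<longrightarrow> form_eval (wform (w \<phi> u) u (\<phi> u)) v \<noteq> 0) \<and>
    (\<forall>\<Psi> \<sigma> P. \<Psi> \<subseteq> \<Phi> \<longrightarrow> \<sigma> ` \<Psi> \<subseteq> V \<longrightarrow> P \<notin> V \<longrightarrow>
      (\<forall>\<phi>\<in>\<Psi>. form_eval (wform (w \<phi> (\<sigma> \<phi>)) (\<sigma> \<phi>) (\<phi> (\<sigma> \<phi>))) P = 0) \<longrightarrow>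
      card \<Psi> \<le> vec.dim ((\<lambda>\<phi>. wform (w \<phi> (\<sigma> \<phi>)) (\<sigma> \<phi>) (\<phi> (\<sigma> \<phi>))) ` \<Psi>))"
proof -
  define C where "C w \<phi> v = wform (w \<phi> v) v (\<phi> v)"
    for w :: "(complex ^ 'n \<Rightarrow> 'n option) \<Rightarrow> complex ^ 'n \<Rightarrow> 'n option \<Rightarrow> real" and \<phi> v
  have "\<exists>w. (\<forall>\<phi>\<in>\<Phi>. \<forall>v\<in>V. (\<forall>j. w \<phi> v j > 0) \<and> (\<forall>u\<in>V. u \<noteq> v \<longrightarrow> form_eval (C w \<phi> v) u \<noteq> 0)) \<and>
     (\<forall>\<Psi> \<sigma> P. \<Psi> \<subseteq> \<Phi> \<longrightarrow> \<sigma> ` \<Psi> \<subseteq> V \<longrightarrow> P \<notin> V \<longrightarrow> (\<forall>\<phi>\<in>\<Psi>. form_eval (C w \<phi> (\<sigma> \<phi>)) P = 0) \<longrightarrow>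
        card \<Psi> \<le> vec.dim ((\<lambda>\<phi>. C w \<phi> (\<sigma> \<phi>)) ` \<Psi>))"
    using \<Phi>
  proof (induction \<Phi> rule: finite_induct)
    case (insert \<phi> \<Phi>)
    then obtain w where
      pos: "\<And>\<psi> v j. \<lbrakk>\<psi> \<in> \<Phi>; v \<in> V\<rbrakk> \<Longrightarrow> w \<psi> v j > 0" and
      nz: "\<And>\<psi> v u. \<lbrakk>\<psi> \<in> \<Phi>; v \<in> V; u \<in> V; u \<noteq> v\<rbrakk> \<Longrightarrow> form_eval (C w \<psi> v) u \<noteq> 0" and
      dim: "\<And>\<Psi> \<sigma> P. \<lbrakk>\<Psi> \<subseteq> \<Phi>; \<sigma> ` \<Psi> \<subseteq> V; P \<notin> V; \<forall>\<psi>\<in>\<Psi>. form_eval (C w \<psi> (\<sigma> \<psi>)) P = 0\<rbrakk>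
        \<Longrightarrow> card \<Psi> \<le> vec.dim ((\<lambda>\<psi>. C w \<psi> (\<sigma> \<psi>)) ` \<Psi>)"
      by blast
    define L where "L \<Psi> \<sigma> = {P. \<forall>\<psi>\<in>\<Psi>. form_eval (C w \<psi> (\<sigma> \<psi>)) P = 0}" for \<Psi> \<sigma>
    define I where "I = Sigma (Pow \<Phi>) (\<lambda>\<Psi>. \<Psi> \<rightarrow>\<^sub>E V)"
    \<comment> \<open>Points where the new form at \<open>v\<close> must not vanish: the rest of
      \<open>V\<close>, and for each earlier selection one common zero other than \<open>v\<close>.
      If there is no such zero, the chosen point is arbitrary and harmless.\<close>
    define F where "F v = (V \<union> (\<lambda>(\<Psi>, \<sigma>). SOME Q. Q \<in> L \<Psi> \<sigma> - {v}) ` I) - {v}" for v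
    have "finite I"
      unfolding I_def using insert.hyps V(1)
      by (intro finite_SigmaI) (auto intro: finite_PiE finite_subset)
    then have finF: "finite (F v)" for v
      using V(1) by (auto simp: F_def)
    have "\<exists>y. (\<forall>j. y j > 0) \<and> (\<forall>Q\<in>F v. form_eval (wform y v (\<phi> v)) Q \<noteq> 0)" if v: "v \<in> V" for v
    proof -
      have "v \<notin> F v" "v \<in> torus"
        using v V(2) by (auto simp: F_def)
      from positive_weights_avoiding[OF finF this] show ?thesis
        by metis
    qed
    then have "\<forall>v\<in>V. \<exists>y. (\<forall>j. y j > 0) \<and> (\<forall>Q\<in>F v. form_eval (wform y v (\<phi> v)) Q \<noteq> 0)"
      by blast
    from bchoice[OF this] obtain y where
      y: "\<forall>v\<in>V. (\<forall>j. y v j > 0) \<and> (\<forall>Q\<in>F v. form_eval (wform (y v) v (\<phi> v)) Q \<noteq> 0)"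
      by blast
    then have yF: "form_eval (wform (y v) v (\<phi> v)) Q \<noteq> 0" if "v \<in> V" "Q \<in> F v" for v Q
      using that by blast
    let ?w = "w(\<phi> := y)"
    have C_old: "C ?w \<psi> = C w \<psi>" if "\<psi> \<in> \<Phi>" for \<psi>
    proof -
      have "\<psi> \<noteq> \<phi>"
        using that insert.hyps by auto
      then show ?thesis
        by (intro ext) (simp add: C_def)
    qed
    have C_new: "C ?w \<phi> v = wform (y v) v (\<phi> v)" for v
      by (simp add: C_def)
    have new_dim: "card \<Psi> \<le> vec.dim ((\<lambda>\<psi>. C ?w \<psi> (\<sigma> \<psi>)) ` \<Psi>)"
      if \<Psi>: "\<Psi> \<subseteq> insert \<phi> \<Phi>" and \<sigma>: "\<sigma> ` \<Psi> \<subseteq> V" and P: "P \<notin> V"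
        and zero: "\<forall>\<psi>\<in>\<Psi>. form_eval (C ?w \<psi> (\<sigma> \<psi>)) P = 0" for \<Psi> \<sigma> P
    proof (cases "\<phi> \<in> \<Psi>")
      case False
      then have "\<Psi> \<subseteq> \<Phi>"
        using \<Psi> by auto
      moreover from this have old: "C ?w \<psi> (\<sigma> \<psi>) = C w \<psi> (\<sigma> \<psi>)" if "\<psi> \<in> \<Psi>" for \<psi>
        using C_old that by auto
      ultimately show ?thesis
        using dim[OF _ \<sigma> P] zero by (simp cong: image_cong)
    next
      case True
      define \<Psi>' where "\<Psi>' = \<Psi> - {\<phi>}"
      have \<Psi>': "\<Psi>' \<subseteq> \<Phi>" "\<sigma> ` \<Psi>' \<subseteq> V" "\<Psi> = insert \<phi> \<Psi>'" "\<phi> \<notin> \<Psi>'"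
        using \<Psi> \<sigma> True by (auto simp: \<Psi>'_def)
      then have "finite \<Psi>'"
        using insert.hyps finite_subset by blast
      have old: "C ?w \<psi> (\<sigma> \<psi>) = C w \<psi> (\<sigma> \<psi>)" if "\<psi> \<in> \<Psi>'" for \<psi>
        using C_old that \<Psi>' by auto
      let ?S = "(\<lambda>\<psi>. C w \<psi> (\<sigma> \<psi>)) ` \<Psi>'"
      have zero': "\<forall>\<psi>\<in>\<Psi>'. form_eval (C w \<psi> (\<sigma> \<psi>)) P = 0"
        using zero old \<Psi>'(3) by auto
      from dim[OF \<Psi>'(1,2) P this] have le: "card \<Psi>' \<le> vec.dim ?S" .
      let ?v = "\<sigma> \<phi>"
      have vV: "?v \<in> V"
        using \<sigma> True by auto
      \<comment> \<open>Only extensional selections belong to \<open>I\<close>, which keeps it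
        finite. As \<open>P \<notin> V\<close>, the point \<open>P\<close> is a common zero other
        than \<open>?v\<close>.\<close>
      let ?\<sigma> = "restrict \<sigma> \<Psi>'"
      have "L \<Psi>' ?\<sigma> = L \<Psi>' \<sigma>"
        by (auto simp: L_def)
      with zero' P vV have "P \<in> L \<Psi>' ?\<sigma> - {?v}"
        by (auto simp: L_def)
      define Q where "Q = (SOME Q. Q \<in> L \<Psi>' ?\<sigma> - {?v})"
      have Q: "Q \<in> L \<Psi>' ?\<sigma> - {?v}"
        unfolding Q_def by (rule someI[of _ P]) fact
      have "(\<Psi>', ?\<sigma>) \<in> I"
        using \<Psi>' by (auto simp: I_def)
      then have "Q \<in> F ?v"
        using Q unfolding F_def Q_def by force
      then have new: "form_eval (C ?w \<phi> ?v) Q \<noteq> 0"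
        unfolding C_new using yF vV by blast
      \<comment> \<open>Combinations of the earlier forms vanish at \<open>Q\<close> while the new
        form does not, so it raises the dimension.\<close>
      have "form_eval s Q = 0" if "s \<in> vec.span ?S" for s
        by (rule form_eval_span_eq_0[OF _ that]) (use Q in \<open>auto simp: L_def\<close>)
      with new have "C ?w \<phi> ?v \<notin> vec.span ?S"
        by blast
      then have "vec.dim (insert (C ?w \<phi> ?v) ?S) = Suc (vec.dim ?S)"
        by (simp add: vec.dim_insert)
      moreover have "(\<lambda>\<psi>. C ?w \<psi> (\<sigma> \<psi>)) ` \<Psi> = insert (C ?w \<phi> ?v) ?S"
        unfolding \<Psi>'(3) image_insert by (rule arg_cong[where f = "insert _"], rule image_cong[OF refl old])
      moreover have "card \<Psi> = Suc (card \<Psi>')"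
        using \<Psi>' \<open>finite \<Psi>'\<close> by simp
      ultimately show ?thesis
        using le by simp
    qed
    have new_pos: "?w \<psi> v j > 0" if "\<psi> \<in> insert \<phi> \<Phi>" "v \<in> V" for \<psi> v j
      using pos y that by auto
    have new_nz: "form_eval (C ?w \<psi> v) u \<noteq> 0" if "\<psi> \<in> insert \<phi> \<Phi>" "v \<in> V" "u \<in> V" "u \<noteq> v" for \<psi> v u
    proof (cases "\<psi> = \<phi>")
      case True
      have "u \<in> F v"
        using that by (simp add: F_def)
      then show ?thesis
        unfolding True C_new by (rule yF[OF that(2)])
    next
      case False
      then show ?thesis
        using that nz C_old by auto
    qed
    show ?case
      by (intro exI[of _ ?w] conjI ballI allI impI) (rule new_dim new_nz new_pos; assumption)+
  qed auto
  then obtain w where w: "\<forall>\<phi>\<in>\<Phi>. \<forall>v\<in>V. (\<forall>j. w \<phi> v j > 0) \<and> (\<forall>u\<in>V. u \<noteq> v \<longrightarrow> form_eval (C w \<phi> v) u \<noteq> 0)"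
    and dim: "\<forall>\<Psi> \<sigma> P. \<Psi> \<subseteq> \<Phi> \<longrightarrow> \<sigma> ` \<Psi> \<subseteq> V \<longrightarrow> P \<notin> V \<longrightarrow> (\<forall>\<phi>\<in>\<Psi>. form_eval (C w \<phi> (\<sigma> \<phi>)) P = 0) \<longrightarrow>
        card \<Psi> \<le> vec.dim ((\<lambda>\<phi>. C w \<phi> (\<sigma> \<phi>)) ` \<Psi>)"
    by blast
  show ?thesis
  proof (intro exI[of _ w] conjI ballI allI impI)
    show "w \<phi> v j > 0" if "\<phi> \<in> \<Phi>" "v \<in> V" for \<phi> v j
      using w that by blast
    show "form_eval (wform (w \<phi> u) u (\<phi> u)) v \<noteq> 0" if "\<phi> \<in> \<Phi>" "u \<in> V" "v \<in> V" "u \<noteq> v" for \<phi> u v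
      using w that(1-3) that(4)[symmetric] unfolding C_def by blast
    show "card \<Psi> \<le> vec.dim ((\<lambda>\<phi>. wform (w \<phi> (\<sigma> \<phi>)) (\<sigma> \<phi>) (\<phi> (\<sigma> \<phi>))) ` \<Psi>)"
      if "\<Psi> \<subseteq> \<Phi>" "\<sigma> ` \<Psi> \<subseteq> V" "P \<notin> V"
        "\<forall>\<phi>\<in>\<Psi>. form_eval (wform (w \<phi> (\<sigma> \<phi>)) (\<sigma> \<phi>) (\<phi> (\<sigma> \<phi>))) P = 0" for \<Psi> \<sigma> P
      by (rule dim[unfolded C_def, THEN spec, THEN spec, THEN spec,
            THEN mp, THEN mp, THEN mp, THEN mp, OF that])
  qed
qed

text \<open>Forms of full rank span the constant form \<open>1\<close>, which vanishes
  nowhere.\<close>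

lemma no_common_zero_if_dim_full:
  fixes S :: "(complex ^ 'n::finite option) set"
  assumes "CARD('n option) \<le> vec.dim S"
  obtains s where "s \<in> S" "form_eval s P \<noteq> 0"
proof -
  have "\<exists>s\<in>S. form_eval s P \<noteq> 0"
  proof (rule ccontr)
    assume "\<not> ?thesis"
    then have zero: "form_eval s P = 0" if "s \<in> S" for s
      using that by blast
    have "vec.dim S = vec.dim (UNIV :: (complex ^ 'n option) set)"
      using assms dim_subset_UNIV_cart_gen[of S] unfolding vec_dim_card by linarith
    then have "vec.span S = UNIV"
      by (metis vec.dim_eq_full vec.span_UNIV)
    then have "axis None 1 \<in> vec.span S"
      by simp
    then have "form_eval (axis None 1) P = 0"
      using form_eval_span_eq_0[OF zero] by blast
    then show False
      by (simp add: form_eval_def sum_axis_mult)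
  qed
  with that show thesis
    by blast
qed

section \<open>Counting selections of maximal coordinates\<close>

text \<open>Stars and bars: listing values along an enumeration of the index type embeds these
  functions into lists of fixed length and sum.\<close>

lemma finite_functions_sum_eq: "finite {\<kappa> :: 'i::finite \<Rightarrow> nat. (\<Sum>i\<in>UNIV. \<kappa> i) = k}"
  and card_functions_sum_eq_le:
    "card {\<kappa> :: 'i::finite \<Rightarrow> nat. (\<Sum>i\<in>UNIV. \<kappa> i) = k} \<le> (k + CARD('i) - 1) choose k"
proof -
  let ?K = "{\<kappa> :: 'i \<Rightarrow> nat. (\<Sum>i\<in>UNIV. \<kappa> i) = k}"
  let ?L = "{l :: nat list. length l = CARD('i) \<and> sum_list l = k}"
  obtain xs :: "'i list" where xs: "set xs = UNIV" "distinct xs"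
    using finite_distinct_list[of "UNIV :: 'i set"] by auto
  have "?L \<subseteq> {l. set l \<subseteq> {..k} \<and> length l = CARD('i)}"
    by (auto dest: member_le_sum_list)
  then have fin: "finite ?L"
    by (rule finite_subset) (simp add: finite_lists_length_eq)
  have inj: "inj_on (\<lambda>\<kappa>. map \<kappa> xs) ?K"
    using xs by (auto simp: inj_on_def fun_eq_iff)
  have "length xs = CARD('i)"
    using xs distinct_card by metis
  then have sub: "(\<lambda>\<kappa>. map \<kappa> xs) ` ?K \<subseteq> ?L"
    using xs by (auto simp: sum_list_distinct_conv_sum_set)
  show "finite ?K"
    using inj_on_finite[OF inj sub fin] .
  show "card ?K \<le> (k + CARD('i) - 1) choose k"
    using card_inj_on_le[OF inj sub fin] by (simp add: card_length_sum_list)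
qed

text \<open>Equality holds at \<open>k = 1\<close>, and raising \<open>k\<close> by one multiplies
  the left side by (k + n + 1) / (k + 1), which is at most \<open>n\<close>. For
  \<open>n = 1\<close> the bound fails from \<open>k = 2\<close> on.\<close>

lemma binomial_le_mult_power:
  assumes "n \<ge> 2" "k \<ge> 1"
  shows "(k + n) choose k \<le> (n + 1) * n ^ (k - 1)"
  using assms(2)
proof (induction k rule: dec_induct)
  case (step k)
  obtain m where n: "n = m + 2"
    using assms(1) by (metis add.commute le_Suc_ex)
  have "Suc (k + n) \<le> Suc k * n"
    using step.hyps by (simp add: n algebra_simps)
  then have "Suc (k + n) * ((k + n) choose k) \<le> Suc k * n * ((n + 1) * n ^ (k - 1))"
    using step.IH by (intro mult_mono) auto
  also have "\<dots> = Suc k * ((n + 1) * n ^ k)"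
    using step.hyps by (cases k) (simp_all add: algebra_simps)
  finally have "Suc k * ((Suc k + n) choose Suc k) \<le> Suc k * ((n + 1) * n ^ k)"
    using Suc_times_binomial_eq[of "k + n" k] by (simp only: add_Suc mult.commute)
  then show ?case
    by (simp only: mult_le_cancel1) simp
qed auto

text \<open>Among all selections with prescribed fibre sizes, one minimising \<open>\<Sum>\<^sub>v h v (\<phi> v)\<close> picks a maximal
  coordinate of \<open>x - h v\<close> for every \<open>v\<close> as soon as any of them does. Hence it suffices to keep one
  selection per vector of fibre sizes.\<close>

lemma argmax_selections:
  fixes V :: "'v set" and h :: "'v \<Rightarrow> 'i::finite \<Rightarrow> real"
  assumes V: "finite V"
  obtains \<Phi> where "finite \<Phi>" "card \<Phi> \<le> (card V + CARD('i) - 1) choose card V"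
    and "\<And>x :: 'i \<Rightarrow> real. \<exists>\<phi>\<in>\<Phi>. \<forall>v\<in>V. \<forall>j. x j - h v j \<le> x (\<phi> v) - h v (\<phi> v)"
proof -
  define X where "X = V \<rightarrow>\<^sub>E (UNIV :: 'i set)"
  define cnt where "cnt \<phi> i = card {v\<in>V. \<phi> v = i}" for \<phi> :: "'v \<Rightarrow> 'i" and i
  define cost where "cost \<phi> = (\<Sum>v\<in>V. h v (\<phi> v))" for \<phi>
  define rep where "rep \<kappa> = arg_min_on cost {\<phi>\<in>X. cnt \<phi> = \<kappa>}" for \<kappa>
  have X: "finite X"
    unfolding X_def using V by (intro finite_PiE) auto
  \<comment> \<open>Summing a function of the selected coordinate depends only on the fibre
    sizes.\<close>
  have cnt_sum: "(\<Sum>v\<in>V. g (\<phi> v)) = (\<Sum>i\<in>UNIV. real (cnt \<phi> i) * g i)" for g :: "'i \<Rightarrow> real" and \<phi>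
  proof -
    have "(\<Sum>v\<in>V. g (\<phi> v)) = (\<Sum>i\<in>UNIV. \<Sum>v\<in>{v\<in>V. \<phi> v = i}. g (\<phi> v))"
      by (rule sum.group[symmetric]) (use V in auto)
    then show ?thesis
      by (simp add: cnt_def)
  qed
  have "(\<Sum>i\<in>UNIV. cnt \<phi> i) = card V" for \<phi>
    using cnt_sum[of "\<lambda>_. 1" \<phi>] by simp (metis of_nat_eq_iff of_nat_sum)
  then have sub: "cnt ` X \<subseteq> {\<kappa>. (\<Sum>i\<in>UNIV. \<kappa> i) = card V}"
    by auto
  have "card (rep ` cnt ` X) \<le> card (cnt ` X)"
    using X by (intro card_image_le) auto
  also have "\<dots> \<le> card {\<kappa> :: 'i \<Rightarrow> nat. (\<Sum>i\<in>UNIV. \<kappa> i) = card V}"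
    by (intro card_mono finite_functions_sum_eq sub)
  also have "\<dots> \<le> (card V + CARD('i) - 1) choose card V"
    by (rule card_functions_sum_eq_le)
  finally have card: "card (rep ` cnt ` X) \<le> (card V + CARD('i) - 1) choose card V" .
  have max: "\<exists>\<phi>\<in>rep ` cnt ` X. \<forall>v\<in>V. \<forall>j. x j - h v j \<le> x (\<phi> v) - h v (\<phi> v)" for x :: "'i \<Rightarrow> real"
  proof -
    have "\<exists>i. \<forall>j. x j - h v j \<le> x i - h v i" for v
    proof -
      have "Max (range (\<lambda>j. x j - h v j)) \<in> range (\<lambda>j. x j - h v j)"
        by (intro Max_in) auto
      then obtain i where "Max (range (\<lambda>j. x j - h v j)) = x i - h v i"
        by (rule rangeE)
      moreover have "x j - h v j \<le> Max (range (\<lambda>j. x j - h v j))" for j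
        by (intro Max_ge) auto
      ultimately show ?thesis
        by (intro exI[of _ i]) simp
    qed
    then obtain \<mu> where \<mu>: "\<And>v j. x j - h v j \<le> x (\<mu> v) - h v (\<mu> v)"
      by metis
    \<comment> \<open>A pointwise maximal selection; it is compared with the representative
      \<open>\<phi>\<close> of the same fibre sizes.\<close>
    let ?\<mu> = "restrict \<mu> V"
    define \<phi> where "\<phi> = rep (cnt ?\<mu>)"
    have \<mu>X: "?\<mu> \<in> {\<psi>\<in>X. cnt \<psi> = cnt ?\<mu>}"
      by (simp add: X_def)
    have finX: "finite {\<psi>\<in>X. cnt \<psi> = cnt ?\<mu>}"
      using X by auto
    have \<phi>: "cnt \<phi> = cnt ?\<mu>" "cost \<phi> \<le> cost ?\<mu>"
      using arg_min_if_finite(1)[OF finX, of cost] arg_min_least[OF finX _ \<mu>X, of cost] \<mu>X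
      unfolding \<phi>_def rep_def by auto
    have "(\<Sum>v\<in>V. x (\<phi> v)) = (\<Sum>v\<in>V. x (?\<mu> v))"
      unfolding cnt_sum \<phi>(1) ..
    \<comment> \<open>The \<open>x\<close> terms cancel and \<open>\<phi>\<close> costs no more, so
      its nonnegative deficits have nonpositive sum and all vanish.\<close>
    then have "(\<Sum>v\<in>V. (x (\<mu> v) - h v (\<mu> v)) - (x (\<phi> v) - h v (\<phi> v))) \<le> 0"
      using \<phi>(2) by (simp add: cost_def sum_subtractf)
    moreover have nonneg: "0 \<le> (x (\<mu> v) - h v (\<mu> v)) - (x (\<phi> v) - h v (\<phi> v))" for v
      using \<mu>[of "\<phi> v" v] by simp
    ultimately have "(\<Sum>v\<in>V. (x (\<mu> v) - h v (\<mu> v)) - (x (\<phi> v) - h v (\<phi> v))) = 0"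
      by (intro antisym sum_nonneg)
    then have "(x (\<mu> v) - h v (\<mu> v)) - (x (\<phi> v) - h v (\<phi> v)) = 0" if "v \<in> V" for v
      using that V nonneg by (subst (asm) sum_nonneg_eq_0_iff) auto
    then have "x (\<phi> v) - h v (\<phi> v) = x (\<mu> v) - h v (\<mu> v)" if "v \<in> V" for v
      using that by simp
    with \<mu> have "\<forall>v\<in>V. \<forall>j. x j - h v j \<le> x (\<phi> v) - h v (\<phi> v)"
      by simp
    moreover have "\<phi> \<in> rep ` cnt ` X"
      using \<mu>X unfolding \<phi>_def by blast
    ultimately show ?thesis
      by blast
  qed
  show thesis
    by (rule that[of "rep ` cnt ` X"]) (use X card max in auto)
qed

section \<open>Amoeba bases\<close>

definition hlog :: "real ^ 'n \<Rightarrow> 'n option \<Rightarrow> real" where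
  "hlog x j = (case j of None \<Rightarrow> 0 | Some k \<Rightarrow> x $ k)"

lemma cmod_hcoord: "z \<in> torus \<Longrightarrow> cmod (hcoord z j) = exp (hlog (Log z) j)"
  by (cases j) (auto simp: torus_def hlog_def Log_def)

text \<open>The direction in which the homogeneous coordinate \<open>i\<close> grows relative to all others.\<close>

definition hdir :: "'n::finite option \<Rightarrow> real ^ 'n" where
  "hdir i = (case i of None \<Rightarrow> (\<chi> k. - 1) | Some k \<Rightarrow> axis k 1)"

lemma hdir_nonzero: "hdir i \<noteq> 0"
  by (cases i) (simp_all add: hdir_def axis_eq_0_iff, simp add: vec_eq_iff)

text \<open>A form with distinguished index \<open>i'\<close> cannot exclude small displacements of
  \<open>Log v\<close> in the direction of another index \<open>i\<close>. Among the ratios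
  \<open>Y\<close>, the entry at \<open>i\<close> gets modulus \<open>exp \<epsilon>\<close> and
  phase \<open>\<theta>\<close>, the entry at \<open>i'\<close> a value \<open>\<tau>\<close>, and
  all others are \<open>1\<close>; vanishing expresses \<open>\<tau>\<close> through
  \<open>\<theta>\<close>.\<close>

lemma wform_zero_over_perturbation:
  fixes v :: "complex ^ 'n::finite"
  assumes w: "\<And>j. w j > 0" and v: "v \<in> torus" and i: "i \<noteq> i'" and \<epsilon>: "\<epsilon> > 0"
    and small: "w i * (exp \<epsilon> - 1) \<le> 2 * (\<Sum>j\<in>UNIV - {i, i'}. w j)"
  obtains z where "z \<in> torus" "form_eval (wform w v i') z = 0" "Log z = Log v + \<epsilon> *\<^sub>R hdir i"
proof -
  define a where "a = (\<Sum>j\<in>UNIV - {i, i'}. w j)"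
  define b where "b = w i * exp \<epsilon>"
  have a: "a \<ge> 0"
    unfolding a_def using w by (intro sum_nonneg) (simp add: less_imp_le)
  have b: "b \<ge> w i"
    unfolding b_def using w[of i] \<epsilon> by simp
  let ?N = "\<lambda>\<theta>. cmod (of_real a + of_real b * cis \<theta>)"
  \<comment> \<open>This makes \<open>\<tau>\<close> unimodular: at \<open>\<theta> = 0\<close> the
    lengths \<open>a\<close> and \<open>b\<close> add up, and at \<open>\<theta> = pi\<close> the
    hypothesis \<open>small\<close> bounds their difference.\<close>
  have "\<exists>\<theta>\<ge>0. \<theta> \<le> pi \<and> ?N \<theta> = a + w i"
  proof (rule IVT2')
    have "?N pi = \<bar>a - b\<bar>"
      by (simp add: norm_of_real flip: of_real_diff)
    also have "\<dots> \<le> a + w i"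
      using small a b w[of i] unfolding a_def[symmetric] by (auto simp: b_def abs_le_iff algebra_simps)
    finally show "?N pi \<le> a + w i" .
    have "?N 0 = a + b"
      using a b w[of i] by (simp flip: of_real_add)
    with b show "a + w i \<le> ?N 0"
      by simp
    show "continuous_on {0..pi} ?N"
      by (intro continuous_intros)
  qed simp
  then obtain \<theta> where \<theta>: "?N \<theta> = a + w i"
    by blast
  define \<tau> where "\<tau> = (of_real a + of_real b * cis \<theta>) / of_real (a + w i)"
  have aw: "a + w i > 0"
    using a w[of i] by simp
  have \<tau>: "cmod \<tau> = 1"
    unfolding \<tau>_def norm_divide \<theta> using aw by (simp del: of_real_add)
  define Y where "Y j = (if j = i then of_real (exp \<epsilon>) * cis \<theta> else if j = i' then \<tau> else 1)" for j
  have Y: "cmod (Y j) = (if j = i then exp \<epsilon> else 1)" for j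
    using \<tau> by (simp add: Y_def norm_mult)
  then have Y0: "Y j \<noteq> 0" for j
    by (metis exp_not_eq_zero norm_zero zero_neq_one)
  \<comment> \<open>Division by \<open>Y None\<close> returns to the chart; for
    \<open>i = None\<close> it turns growth of that coordinate into a decrease of all
    others.\<close>
  define z where "z = (\<chi> k. v $ k * Y (Some k) / Y None)"
  have ratio: "hcoord z j / hcoord v j = Y j / Y None" for j
    using Y0 v by (cases j) (auto simp: z_def torus_def)
  have "(\<Sum>j\<in>UNIV. of_real (w j) * (Y j - Y i')) =
      (\<Sum>j\<in>UNIV - {i, i'}. of_real (w j) * (1 - \<tau>)) + of_real (w i) * (Y i - \<tau>)"
  proof -
    have "(\<Sum>j\<in>UNIV. of_real (w j) * (Y j - Y i')) =
        (\<Sum>j\<in>UNIV - {i, i'}. of_real (w j) * (Y j - Y i')) + (\<Sum>j\<in>{i, i'}. of_real (w j) * (Y j - Y i'))"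
      by (rule sum.subset_diff) auto
    then show ?thesis
      using i by (simp add: Y_def)
  qed
  also have "\<dots> = of_real a * (1 - \<tau>) + of_real (w i) * (of_real (exp \<epsilon>) * cis \<theta> - \<tau>)"
    by (simp add: a_def Y_def sum_distrib_right)
  also have "\<dots> = of_real a + of_real b * cis \<theta> - of_real (a + w i) * \<tau>"
    by (simp add: b_def algebra_simps)
  also have "\<dots> = 0"
    using aw by (simp add: \<tau>_def del: of_real_add)
  finally have sum0: "(\<Sum>j\<in>UNIV. of_real (w j) * (Y j - Y i')) = 0" .
  have "form_eval (wform w v i') z = (\<Sum>j\<in>UNIV. of_real (w j) * (Y j - Y i')) / Y None"
    unfolding form_eval_wform ratio by (simp add: sum_divide_distrib flip: diff_divide_distrib)
  then have "form_eval (wform w v i') z = 0"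
    by (simp add: sum0)
  moreover have zt: "z \<in> torus"
    using v Y0 by (simp add: torus_def z_def)
  moreover have "Log z = Log v + \<epsilon> *\<^sub>R hdir i"
  proof (rule vec_eq_iff[THEN iffD2, rule_format])
    fix k
    have "v $ k \<noteq> 0"
      using v by (simp add: torus_def)
    then have "Log z $ k = Log v $ k + ln (cmod (Y (Some k))) - ln (cmod (Y None))"
      using Y0 by (simp add: Log_def z_def norm_mult norm_divide ln_mult ln_div)
    then show "Log z $ k = (Log v + \<epsilon> *\<^sub>R hdir i) $ k"
      by (cases i) (auto simp: Y hdir_def axis_def)
  qed
  ultimately show thesis
    using that by blast
qed

section \<open>Products of forms and their amoebas\<close>

lemma hypersurface_prod_forms:
  assumes "finite V"
  shows "hypersurface (\<Prod>v\<in>V. form_poly (c v)) = {z \<in> torus. \<exists>v\<in>V. form_eval (c v) z = 0}"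
  using assms by (auto simp: hypersurface_def)

lemma total_degree_prod_forms_le: "total_degree (\<Prod>v\<in>V. form_poly (c v)) \<le> card V"
proof -
  have "total_degree (\<Prod>v\<in>V. form_poly (c v)) \<le> (\<Sum>v\<in>V. total_degree (form_poly (c v)))"
    by (rule total_degree_prod_le)
  also have "\<dots> \<le> (\<Sum>v\<in>V. 1)"
    by (intro sum_mono total_degree_form_poly_le)
  finally show ?thesis
    by simp
qed

text \<open>This is the irredundancy of a one-element basis: without its element the intersection is
  the whole space.\<close>

lemma amoeba_finite_psubset_UNIV:
  assumes "finite V"
  shows "amoeba V \<subset> UNIV"
proof -
  have "bounded (amoeba V)"
    using assms by (simp add: amoeba_def finite_imp_bounded)
  then have "amoeba V \<noteq> UNIV"
    using not_bounded_UNIV by metis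
  then show ?thesis
    by blast
qed

text \<open>In one variable a centred form vanishes only at its centre, and for empty
  \<open>V\<close> the product is \<open>1\<close>; either way the hypersurface is \<open>V\<close>
  itself.\<close>

lemma amoeba_basis_singleton:
  fixes V :: "(complex ^ 'n::finite) set"
  assumes V: "finite V" "V \<subseteq> torus" and "CARD('n) = 1 \<or> V = {}"
  obtains g where "amoeba_basis V {g}" "total_degree g \<le> card V"
proof -
  define c :: "complex ^ 'n \<Rightarrow> complex ^ 'n option" where "c v = wform (\<lambda>_. 1) v None" for v
  define g where "g = (\<Prod>v\<in>V. form_poly (c v))"
  have c_zero: "form_eval (c v) z = 0 \<longleftrightarrow> z = v" if v: "v \<in> V" for v z
  proof -
    obtain k :: 'n where k: "UNIV = {k}"
      using assms(3) v by (auto simp: card_1_singleton_iff)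
    have "v $ k \<noteq> 0"
      using v V(2) by (auto simp: torus_def)
    then have "form_eval (c v) z = 0 \<longleftrightarrow> z $ k = v $ k"
      by (simp add: c_def form_eval_wform sum_UNIV_option k)
    moreover have "z = v \<longleftrightarrow> z $ k = v $ k"
      using k unfolding vec_eq_iff by (metis UNIV_I singletonD)
    ultimately show ?thesis
      by simp
  qed
  have "module.span (*) ((\<lambda>_::unit. \<Prod>v\<in>V. form_poly (c v)) ` UNIV) = vanishing_ideal V"
    using c_zero by (intro span_prod_forms_eq_vanishing_ideal V) (auto, metis rangeI subsetD)
  then have span: "module.span (*) {g} = vanishing_ideal V"
    by (simp add: g_def UNIV_unit)
  have "hypersurface g = V"
    using c_zero V by (auto simp: g_def hypersurface_prod_forms)
  then have "amoeba_basis V {g}"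
    using span amoeba_finite_psubset_UNIV[OF V(1)] by (simp add: amoeba_basis_def)
  moreover have "total_degree g \<le> card V"
    unfolding g_def by (rule total_degree_prod_forms_le)
  ultimately show thesis
    by (rule that)
qed

text \<open>In a subfamily of least cardinality with intersection \<open>S\<close>, dropping a
  member must change the intersection.\<close>

lemma minimal_subfamily:
  assumes "finite \<Phi>" "(\<Inter>\<phi>\<in>\<Phi>. A \<phi>) = S"
  obtains \<Psi> where "\<Psi> \<subseteq> \<Phi>" "(\<Inter>\<phi>\<in>\<Psi>. A \<phi>) = S" "\<forall>\<phi>\<in>\<Psi>. S \<subset> (\<Inter>\<psi>\<in>\<Psi> - {\<phi>}. A \<psi>)"
proof -
  let ?P = "\<lambda>\<Psi>. \<Psi> \<subseteq> \<Phi> \<and> (\<Inter>\<phi>\<in>\<Psi>. A \<phi>) = S"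
  have "?P \<Phi>"
    using assms(2) by simp
  from ex_has_least_nat[of ?P, OF this, of card] obtain \<Psi>
    where "?P \<Psi> \<and> (\<forall>\<Psi>'. ?P \<Psi>' \<longrightarrow> card \<Psi> \<le> card \<Psi>')"
    by (rule exE)
  then have \<Psi>: "\<Psi> \<subseteq> \<Phi>" "(\<Inter>\<phi>\<in>\<Psi>. A \<phi>) = S"
    and min: "\<And>\<Psi>'. ?P \<Psi>' \<Longrightarrow> card \<Psi> \<le> card \<Psi>'"
    by simp_all
  have strict: "S \<subset> (\<Inter>\<psi>\<in>\<Psi> - {\<phi>}. A \<psi>)" if "\<phi> \<in> \<Psi>" for \<phi>
  proof -
    have "card (\<Psi> - {\<phi>}) < card \<Psi>"
      using that \<Psi>(1) assms(1) by (intro card_Diff1_less) (auto intro: finite_subset)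
    then have "(\<Inter>\<psi>\<in>\<Psi> - {\<phi>}. A \<psi>) \<noteq> S"
      using min[of "\<Psi> - {\<phi>}"] \<Psi>(1) by auto
    then show ?thesis
      using \<Psi>(2) by blast
  qed
  show thesis
    by (rule that[OF \<Psi>]) (intro ballI strict)
qed

text \<open>The hypothesis \<open>CARD('n) \<ge> 2\<close> enters twice: in the binomial estimate,
  and to find an index outside \<open>{i, \<phi> v\<^sub>0}\<close>.\<close>

lemma amoeba_basis_exists:
  fixes V :: "(complex ^ 'n::finite) set"
  assumes V: "finite V" "V \<subseteq> torus" "V \<noteq> {}" and n: "CARD('n) \<ge> 2"
  obtains G where "amoeba_basis V G" "card G \<le> (CARD('n) + 1) * CARD('n) ^ (card V - 1)"
    "\<And>g. g \<in> G \<Longrightarrow> total_degree g \<le> card V"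
proof -
  \<comment> \<open>For \<open>y = hlog (Log z)\<close> the differences are the logarithms of |z_j /
    v_j|, so some \<open>\<phi>\<close> selects a coordinate of maximal modulus for every
    \<open>v\<close>.\<close>
  obtain \<Phi> :: "(complex ^ 'n \<Rightarrow> 'n option) set" where \<Phi>: "finite \<Phi>"
      "card \<Phi> \<le> (card V + CARD('n option) - 1) choose card V"
    and argmax: "\<And>y :: 'n option \<Rightarrow> real. \<exists>\<phi>\<in>\<Phi>. \<forall>v\<in>V. \<forall>j.
        y j - hlog (Log v) j \<le> y (\<phi> v) - hlog (Log v) (\<phi> v)"
    using argmax_selections[OF V(1), of "\<lambda>v. hlog (Log v)"] by metis
  from generic_weights[OF V(1,2) \<Phi>(1)] obtain w where
    pos: "\<forall>\<phi>\<in>\<Phi>. \<forall>v\<in>V. \<forall>j. w \<phi> v j > 0" and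
    nz: "\<forall>\<phi>\<in>\<Phi>. \<forall>u\<in>V. \<forall>v\<in>V. u \<noteq> v \<longrightarrow> form_eval (wform (w \<phi> u) u (\<phi> u)) v \<noteq> 0" and
    dim: "\<forall>\<Psi> \<sigma> P. \<Psi> \<subseteq> \<Phi> \<longrightarrow> \<sigma> ` \<Psi> \<subseteq> V \<longrightarrow> P \<notin> V \<longrightarrow>
      (\<forall>\<phi>\<in>\<Psi>. form_eval (wform (w \<phi> (\<sigma> \<phi>)) (\<sigma> \<phi>) (\<phi> (\<sigma> \<phi>))) P = 0) \<longrightarrow>
      card \<Psi> \<le> vec.dim ((\<lambda>\<phi>. wform (w \<phi> (\<sigma> \<phi>)) (\<sigma> \<phi>) (\<phi> (\<sigma> \<phi>))) ` \<Psi>)"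
    by (elim exE conjE)
  define c where "c \<phi> v = wform (w \<phi> v) v (\<phi> v)" for \<phi> v
  define g where "g \<phi> = (\<Prod>v\<in>V. form_poly (c \<phi> v))" for \<phi>
  define A where "A \<phi> = amoeba (hypersurface (g \<phi>))" for \<phi>
  have hyp: "hypersurface (g \<phi>) = {z \<in> torus. \<exists>v\<in>V. form_eval (c \<phi> v) z = 0}" for \<phi>
    unfolding g_def by (rule hypersurface_prod_forms[OF V(1)])
  have c_self: "form_eval (c \<phi> v) v = 0" if "v \<in> V" for \<phi> v
    using that V(2) by (auto simp: c_def)
  have "V \<subseteq> hypersurface (g \<phi>)" for \<phi>
    using V(2) c_self unfolding hyp by blast
  then have VA: "amoeba V \<subseteq> A \<phi>" for \<phi>
    unfolding A_def amoeba_def by (rule image_mono)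
  have "x \<in> amoeba V" if x: "\<forall>\<phi>\<in>\<Phi>. x \<in> A \<phi>" for x
  proof -
    obtain \<phi> where \<phi>: "\<phi> \<in> \<Phi>"
      and max: "\<forall>v\<in>V. \<forall>j. hlog x j - hlog (Log v) j \<le> hlog x (\<phi> v) - hlog (Log v) (\<phi> v)"
      using argmax by blast
    obtain z v where z: "z \<in> torus" "Log z = x" and v: "v \<in> V" "form_eval (c \<phi> v) z = 0"
      using x \<phi> by (auto simp: A_def amoeba_def hyp)
    have vt: "v \<in> torus"
      using v V(2) by auto
    have "z = v"
    proof (rule wform_zero_imp_eq[OF _ vt z(1)])
      show "w \<phi> v j > 0" for j
        using pos \<phi> v by blast
      show "cmod (hcoord z j / hcoord v j) \<le> cmod (hcoord z (\<phi> v) / hcoord v (\<phi> v))" for j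
        using max v(1) by (simp add: norm_divide cmod_hcoord z vt flip: exp_diff)
      show "form_eval (wform (w \<phi> v) v (\<phi> v)) z = 0"
        using v(2) by (simp add: c_def)
    qed
    with z v show ?thesis
      by (auto simp: amoeba_def)
  qed
  with VA have "(\<Inter>\<phi>\<in>\<Phi>. A \<phi>) = amoeba V"
    by blast
  from \<Phi>(1) this obtain \<Psi> where \<Psi>: "\<Psi> \<subseteq> \<Phi>" "(\<Inter>\<phi>\<in>\<Psi>. A \<phi>) = amoeba V"
    and min: "\<forall>\<phi>\<in>\<Psi>. amoeba V \<subset> (\<Inter>\<psi>\<in>\<Psi> - {\<phi>}. A \<psi>)"
    by (rule minimal_subfamily)
  have fin\<Psi>: "finite \<Psi>"
    using \<Psi>(1) \<Phi>(1) by (rule finite_subset)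

  obtain v\<^sub>0 where v\<^sub>0: "v\<^sub>0 \<in> V"
    using V(3) by blast
  then have v\<^sub>0t: "v\<^sub>0 \<in> torus"
    using V(2) by auto
  text \<open>Separating \<open>Log v\<^sub>0\<close> from nearby points in the \<open>n + 1\<close> directions \<open>hdir i\<close> takes \<open>n + 1\<close>
    different members of the family.\<close>
  have card\<Psi>: "CARD('n option) \<le> card \<Psi>"
  proof -
    \<comment> \<open>In a given direction each point is met for at most one
      \<open>\<epsilon>\<close>, because \<open>hdir i\<close> is nonzero.\<close>
    have avoid: "\<forall>\<^sub>F \<epsilon> in at_right 0. Log v\<^sub>0 + \<epsilon> *\<^sub>R hdir i \<noteq> a" for i a
    proof (cases "\<exists>\<delta>. a = Log v\<^sub>0 + \<delta> *\<^sub>R hdir i")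
      case True
      then obtain \<delta> where \<delta>: "a = Log v\<^sub>0 + \<delta> *\<^sub>R hdir i" ..
      have "\<forall>\<^sub>F \<epsilon> in at_right 0. \<epsilon> \<noteq> \<delta>"
        by (rule eventually_neq_at_within)
      then show ?thesis
        by eventually_elim (simp add: \<delta> hdir_nonzero)
    qed (auto intro: always_eventually)
    have "\<forall>\<^sub>F \<epsilon> in at_right 0. \<forall>i\<in>UNIV. \<forall>a\<in>amoeba V. Log v\<^sub>0 + \<epsilon> *\<^sub>R hdir i \<noteq> a"
      using V(1) by (intro eventually_ball_finite ballI avoid) (auto simp: amoeba_def)
    moreover have "\<forall>\<^sub>F \<epsilon> in at_right 0. \<forall>\<phi>\<in>\<Psi>. \<forall>i\<in>UNIV.
        w \<phi> v\<^sub>0 i * (exp \<epsilon> - 1) < 2 * (\<Sum>j\<in>UNIV - {i, \<phi> v\<^sub>0}. w \<phi> v\<^sub>0 j)"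
    proof (intro eventually_ball_finite ballI fin\<Psi> finite_class.finite_UNIV)
      fix \<phi> i assume "\<phi> \<in> \<Psi>"
      \<comment> \<open>There are at least three indices, so the right-hand sum is positive, while
        the left side tends to \<open>0\<close>.\<close>
      have "card {i, \<phi> v\<^sub>0} < CARD('n option)"
        using n by (auto intro: le_less_trans[OF card_insert_le_m1[of 2]])
      then have "UNIV - {i, \<phi> v\<^sub>0} \<noteq> {}"
        by (metis Diff_eq_empty_iff card_mono finite.emptyI finite_insert leD)
      then have "0 < (\<Sum>j\<in>UNIV - {i, \<phi> v\<^sub>0}. w \<phi> v\<^sub>0 j)"
        using pos \<open>\<phi> \<in> \<Psi>\<close> \<Psi>(1) v\<^sub>0 by (intro sum_pos) auto
      moreover have "((\<lambda>\<epsilon>. w \<phi> v\<^sub>0 i * (exp \<epsilon> - 1)) \<longlongrightarrow> w \<phi> v\<^sub>0 i * (exp 0 - 1)) (at_right 0)"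
        by (intro tendsto_intros)
      ultimately show "\<forall>\<^sub>F \<epsilon> in at_right 0. w \<phi> v\<^sub>0 i * (exp \<epsilon> - 1) < 2 * (\<Sum>j\<in>UNIV - {i, \<phi> v\<^sub>0}. w \<phi> v\<^sub>0 j)"
        by (intro order_tendstoD(2)) auto
    qed
    ultimately have "\<forall>\<^sub>F \<epsilon> in at_right (0::real). \<epsilon> > 0 \<and>
        (\<forall>i\<in>UNIV. \<forall>a\<in>amoeba V. Log v\<^sub>0 + \<epsilon> *\<^sub>R hdir i \<noteq> a) \<and>
        (\<forall>\<phi>\<in>\<Psi>. \<forall>i\<in>UNIV. w \<phi> v\<^sub>0 i * (exp \<epsilon> - 1) < 2 * (\<Sum>j\<in>UNIV - {i, \<phi> v\<^sub>0}. w \<phi> v\<^sub>0 j))"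
      by (intro eventually_conj eventually_at_right_less)
    from eventually_happens'[OF trivial_limit_at_right_real this] obtain \<epsilon> where "\<epsilon> > 0 \<and>
        (\<forall>i\<in>UNIV. \<forall>a\<in>amoeba V. Log v\<^sub>0 + \<epsilon> *\<^sub>R hdir i \<noteq> a) \<and>
        (\<forall>\<phi>\<in>\<Psi>. \<forall>i\<in>UNIV. w \<phi> v\<^sub>0 i * (exp \<epsilon> - 1) < 2 * (\<Sum>j\<in>UNIV - {i, \<phi> v\<^sub>0}. w \<phi> v\<^sub>0 j))"
      by (rule exE)
    then have \<epsilon>: "\<epsilon> > 0"
      and notin: "\<And>i. Log v\<^sub>0 + \<epsilon> *\<^sub>R hdir i \<notin> amoeba V"
      and small: "\<And>\<phi> i. \<phi> \<in> \<Psi> \<Longrightarrow> w \<phi> v\<^sub>0 i * (exp \<epsilon> - 1) < 2 * (\<Sum>j\<in>UNIV - {i, \<phi> v\<^sub>0}. w \<phi> v\<^sub>0 j)"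
      by blast+
    have "i \<in> (\<lambda>\<phi>. \<phi> v\<^sub>0) ` \<Psi>" for i
    proof -
      \<comment> \<open>A member excluding the point displaced along \<open>hdir i\<close> must
        select \<open>i\<close> at \<open>v\<^sub>0\<close>.\<close>
      obtain \<phi> where \<phi>: "\<phi> \<in> \<Psi>" "Log v\<^sub>0 + \<epsilon> *\<^sub>R hdir i \<notin> A \<phi>"
        using notin[of i] unfolding \<Psi>(2)[symmetric] by blast
      have "\<phi> v\<^sub>0 = i"
      proof (rule ccontr)
        assume ne: "\<phi> v\<^sub>0 \<noteq> i"
        have "\<And>j. w \<phi> v\<^sub>0 j > 0"
          using pos \<phi>(1) \<Psi>(1) v\<^sub>0 by blast
        then obtain z where "z \<in> torus" "form_eval (c \<phi> v\<^sub>0) z = 0" "Log z = Log v\<^sub>0 + \<epsilon> *\<^sub>R hdir i"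
          using wform_zero_over_perturbation[OF _ v\<^sub>0t ne[symmetric] \<epsilon>, of "w \<phi> v\<^sub>0"]
            less_imp_le[OF small[OF \<phi>(1), of i]] unfolding c_def by blast
        then have "Log v\<^sub>0 + \<epsilon> *\<^sub>R hdir i \<in> A \<phi>"
          using v\<^sub>0 unfolding A_def amoeba_def hyp by (metis (mono_tags, lifting) imageI mem_Collect_eq)
        with \<phi>(2) show False ..
      qed
      with \<phi>(1) show ?thesis
        by blast
    qed
    then have "(\<lambda>\<phi>. \<phi> v\<^sub>0) ` \<Psi> = UNIV"
      by blast
    then show ?thesis
      using card_image_le[OF fin\<Psi>, of "\<lambda>\<phi>. \<phi> v\<^sub>0"] by simp
  qed

  have span: "module.span (*) (g ` \<Psi>) = vanishing_ideal V"
    unfolding g_def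
  proof (rule span_prod_forms_eq_vanishing_ideal[OF V(1) fin\<Psi>])
    show "\<Psi> \<noteq> {}"
      using card\<Psi> by auto
    show "form_eval (c \<phi> v) v = 0" if "v \<in> V" for \<phi> v
      using that by (rule c_self)
    show nonzero: "form_eval (c \<phi> u) v \<noteq> 0" if "\<phi> \<in> \<Psi>" "u \<in> V" "v \<in> V" "u \<noteq> v" for \<phi> u v
      using nz that \<Psi>(1) unfolding c_def by blast
    show "\<sigma> \<phi> = P" if \<sigma>: "\<sigma> ` \<Psi> \<subseteq> V" and P: "\<forall>\<psi>\<in>\<Psi>. form_eval (c \<psi> (\<sigma> \<psi>)) P = 0" and \<phi>: "\<phi> \<in> \<Psi>" for \<sigma> P \<phi>
    proof (rule ccontr)
      assume ne: "\<sigma> \<phi> \<noteq> P"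
      \<comment> \<open>A common zero outside \<open>V\<close> would force rank at least n + 1 on
        the chosen forms, which then have no common zero.\<close>
      have "P \<notin> V"
        using nonzero[OF \<phi> _ _ ne] P \<sigma> \<phi> by blast
      then have "card \<Psi> \<le> vec.dim ((\<lambda>\<phi>. c \<phi> (\<sigma> \<phi>)) ` \<Psi>)"
        using dim \<Psi>(1) \<sigma> P unfolding c_def by simp
      then obtain s where "s \<in> (\<lambda>\<phi>. c \<phi> (\<sigma> \<phi>)) ` \<Psi>" "form_eval s P \<noteq> 0"
        using no_common_zero_if_dim_full card\<Psi> le_trans by metis
      with P show False
        by blast
    qed
  qed

  \<comment> \<open>If several indices give the same polynomial, removing it drops all of them, and
    the intersection only grows.\<close>
  have irredundant: "amoeba V \<subset> (\<Inter>h\<in>g ` \<Psi> - {s}. amoeba (hypersurface h))" if "s \<in> g ` \<Psi>" for s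
  proof -
    obtain \<phi> where "\<phi> \<in> \<Psi>" "s = g \<phi>"
      using \<open>s \<in> g ` \<Psi>\<close> by blast
    then have "(\<Inter>\<psi>\<in>\<Psi> - {\<phi>}. A \<psi>) \<subseteq> (\<Inter>h\<in>g ` \<Psi> - {s}. amoeba (hypersurface h))"
      unfolding A_def by blast
    with bspec[OF min \<open>\<phi> \<in> \<Psi>\<close>] show ?thesis
      by (rule psubset_subset_trans)
  qed
  have "amoeba_basis V (g ` \<Psi>)"
    unfolding amoeba_basis_def using fin\<Psi> span \<Psi>(2) irredundant by (auto simp: A_def)
  moreover have "card (g ` \<Psi>) \<le> (CARD('n) + 1) * CARD('n) ^ (card V - 1)"
  proof -
    have "card (g ` \<Psi>) \<le> card \<Psi>"
      using fin\<Psi> by (rule card_image_le)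
    also have "\<dots> \<le> card \<Phi>"
      using \<Psi>(1) \<Phi>(1) by (intro card_mono)
    also have "\<dots> \<le> (card V + CARD('n)) choose card V"
      using \<Phi>(2) by simp
    also have "\<dots> \<le> (CARD('n) + 1) * CARD('n) ^ (card V - 1)"
      using V by (intro binomial_le_mult_power n) (simp add: Suc_leI card_gt_0_iff)
    finally show ?thesis .
  qed
  moreover have "total_degree h \<le> card V" if "h \<in> g ` \<Psi>" for h
    using that total_degree_prod_forms_le by (auto simp: g_def)
  ultimately show thesis
    by (rule that)
qed

theorem theorem1p1:
  fixes f :: "'n::{finite,linorder} \<Rightarrow> 'n cpoly" and \<mu> :: real
  assumes "generic_system f"
    and "\<mu> = mixed_volume (\<lambda>i. newton_polytope (f i))"
  shows "\<exists>G. amoeba_basis (solution_set f) G \<and>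
           real (card G) \<le> (real CARD('n) + 1) * (real CARD('n) powr (\<mu> - 1) + 1) \<and>
           (\<forall>g\<in>G. real (total_degree g) \<le> \<mu>)"
proof -
  let ?V = "solution_set f" and ?n = "real CARD('n)"
  have V: "finite ?V" "?V \<subseteq> torus" and le: "real (card ?V) \<le> \<mu>"
    using generic_system_card_le[OF assms(1)] assms(2) by (auto simp: solution_set_def)
  show ?thesis
  proof (cases "CARD('n) = 1 \<or> ?V = {}")
    case True
    then obtain g where g: "amoeba_basis ?V {g}" "total_degree g \<le> card ?V"
      using amoeba_basis_singleton[OF V] by blast
    \<comment> \<open>One generator fits the bound because both factors on the right are at least
      \<open>1\<close>.\<close>
    have "1 * 1 \<le> (?n + 1) * (?n powr (\<mu> - 1) + 1)"
      by (intro mult_mono) auto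
    with g le show ?thesis
      by (intro exI[of _ "{g}"]) auto
  next
    case False
    moreover have "CARD('n) \<noteq> 0"
      by simp
    ultimately have n: "CARD('n) \<ge> 2" and ne: "?V \<noteq> {}"
      by linarith+
    obtain G where G: "amoeba_basis ?V G" "card G \<le> (CARD('n) + 1) * CARD('n) ^ (card ?V - 1)"
      "\<And>g. g \<in> G \<Longrightarrow> total_degree g \<le> card ?V"
      using amoeba_basis_exists[OF V ne n] by blast
    have k: "card ?V \<ge> 1"
      using V(1) ne by (simp add: Suc_leI card_gt_0_iff)
    have "real (card G) \<le> real ((CARD('n) + 1) * CARD('n) ^ (card ?V - 1))"
      using G(2) by (simp only: of_nat_le_iff)
    also have "\<dots> = (?n + 1) * ?n ^ (card ?V - 1)"
      by (simp add: distrib_right)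
    \<comment> \<open>As \<open>card ?V \<ge> 1\<close>, truncated subtraction agrees with real
      subtraction.\<close>
    also have "\<dots> = (?n + 1) * ?n powr (real (card ?V) - 1)"
      using k n by (simp add: of_nat_diff flip: powr_realpow)
    also have "\<dots> \<le> (?n + 1) * (?n powr (\<mu> - 1) + 1)"
    proof (intro mult_left_mono)
      have "?n powr (real (card ?V) - 1) \<le> ?n powr (\<mu> - 1)"
        using le n by (intro powr_mono) auto
      then show "?n powr (real (card ?V) - 1) \<le> ?n powr (\<mu> - 1) + 1"
        by simp
    qed simp
    finally have "real (card G) \<le> (?n + 1) * (?n powr (\<mu> - 1) + 1)" .
    moreover have "real (total_degree g) \<le> \<mu>" if "g \<in> G" for g
      using G(3)[OF that] le by linarith
    ultimately show ?thesis
      using G(1) by blast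
  qed
qed

end
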